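(* Let $G$ be a finite abelian group and consider the hidden subgroup problem on $G$ with candidate hidden subgroups $\{H_j\}_{j\in\mathcal J}$ occurring with probabilities $p_j$. Let $\sigma_j^2$ be the state of the input register immediately after the single oracle query of the Shor–Kitaev algorithm, conditioned on class $j$ (output register traced out), let $\rho_Y^2=\sum_jp_j\sigma_j^2$, $\rho_{JY}^2=\sum_jp_j|j\rangle\langle j|\otimes\sigma_j^2$, and let $Y_2$ be the outcome of measuring the input register in the basis $\{|g\rangle\}_{g\in G}$ at this stage. Then: (a) $H(Y_2\mid J)=H(Y_2)=\log|G|$ and $I(J;Y_2)=0$. (b) For all $j,j'\in\mathcal J$: $[\sigma_j^2,\sigma_{j'}^2]=0$ and $\mathrm{Tr}(\sigma_j^2\sigma_{j'}^2)=|H_j\cap H_{j'}|/|G|\ne0$. The minimized discord vanishes: $D_Y(\rho_{JY}^2)=0$. (c) $S(\sigma_j^2)=\log|G|-\log|H_j|$ for every $j$. (d) The vectors $|v_\chi\rangle=|G|^{-1/2}\sum_{g\in G}\chi(g)^*|g\rangle$, $\chi\in\hat G$, form a common orthonormal eigenbasis of all $\sigma_j^2$ and of $\rho_Y^2$, and the eigenvalue of $\rho_Y^2$ on $|v_\chi\rangle$ is $$\lambda_\chi=\frac1{|G|}\sum_{j\in\mathcal J:\ \chi\in H_j^\perp}p_j|H_j|.$$ (e) If $J$ is uniformly distributed, then $\lambda_\chi=\frac{1}{\sqrt{|G|}\,|\mathcal J|}\langle c|v_\chi\rangle$, where $|c\rangle=\sum_{g\in G}c_g|g\rangle$ and $c_g=|\{j\in\mathcal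 J: g\in H_j\}|$.
   Context: Hidden subgroup problem: $\mathcal F$ is a finite set of functions $f:G\to X$ ($X$ a set), each hiding a subgroup $H\subseteq G$, meaning $f(g)=f(g')$ iff $g-g'\in H$. $\mathcal F$ is partitioned into nonempty classes $A_j$, $j\in\mathcal J$, where $A_j$ consists of the functions in $\mathcal F$ hiding $H_j$ (distinct $j$ give distinct subgroups). $F$ is random with $\Pr(F=f)=p_f$, $J$ is its class, and $p_j=\sum_{f\in A_j}p_f>0$. The post-query state for oracle $f$ is $|\psi_2(f)\rangle=|G|^{-1/2}\sum_{g\in G}|g\rangle\otimes|f(g)\rangle$, with $\{|g\rangle\}_{g\in G}$ and $\{|x\rangle\}_{x\in X}$ orthonormal, and $\sigma_j^2=\frac1{p_j}\sum_{f\in A_j}p_f\,\mathrm{Tr}_O|\psi_2(f)\rangle\langle\psi_2(f)|$, where $\mathrm{Tr}_O$ traces out the second (output) register (the superscript 2 is a label, not a square). $\Pr(Y_2=g\mid J=j)=\langle g|\sigma_j^2|g\rangle$. $\hat G=\mathrm{Hom}(G,\mathrm U(1))$ is the character group and $H_j^\perp\subseteq\hat G$ is the subgroup of characters trivial on $H_j$. $H$ with random-variable arguments is Shannon entropy, $I$ mutual information, $S$ von Neumann entropy, with base-2 logarithms. Discord: $D_Y(\rho_{JY})=\min_\Pi D_Y(\rho_{JY};\Pi)$ over projective measurements $\Pi=\{\Pi_k\}$ on $Y$, with $D_Y(\rho_{JY};\Pi)=S(\rho_Y)-S(\rho_{JY})+\sum_kq_kS(\rho_J^k)$, $q_k=\mathrm{Tr}[(I\otimes\Pi_k)\rho_{JY}]$,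 $\rho_J^k=\mathrm{Tr}_Y[(I\otimes\Pi_k)\rho_{JY}(I\otimes\Pi_k)]/q_k$ (terms with $q_k=0$ omitted). *)

theory Defs
  imports "HOL-Probability.Probability" "HOL-Computational_Algebra.Polynomial"
begin

section \<open>Matrices and vectors over \<open>\<complex>\<close>\<close>

definition braket :: "complex ^ 'n \<Rightarrow> complex ^ 'n \<Rightarrow> complex" where
  "braket v w = (\<Sum>i\<in>UNIV. cnj (v $ i) * w $ i)"

definition ketbra :: "complex ^ 'm \<Rightarrow> complex ^ 'n \<Rightarrow> complex ^ 'n ^ 'm" where
  "ketbra v w = (\<chi> i j. v $ i * cnj (w $ j))"

definition conj_transpose :: "complex ^ 'n ^ 'm \<Rightarrow> complex ^ 'm ^ 'n" where
  "conj_transpose A = (\<chi> i j. cnj (A $ j $ i))"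

definition kron ::
  "complex ^ 'm ^ 'm \<Rightarrow> complex ^ 'n ^ 'n \<Rightarrow> complex ^ ('m \<times> 'n) ^ ('m \<times> 'n)" where
  "kron A B = (\<chi> r s. A $ fst r $ fst s * B $ snd r $ snd s)"

definition ptrace_fst :: "complex ^ ('m::finite \<times> 'n::finite) ^ ('m \<times> 'n) \<Rightarrow> complex ^ 'n ^ 'n" where
  "ptrace_fst \<rho> = (\<chi> a b. \<Sum>i\<in>UNIV. \<rho> $ (i, a) $ (i, b))"

definition ptrace_snd :: "complex ^ ('m::finite \<times> 'n::finite) ^ ('m \<times> 'n) \<Rightarrow> complex ^ 'm ^ 'm" where
  "ptrace_snd \<rho> = (\<chi> i j. \<Sum>a\<in>UNIV. \<rho> $ (i, a) $ (j, a))"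

definition charpoly :: "complex ^ 'n ^ 'n \<Rightarrow> complex poly" where
  "charpoly A = det (mat [:0, 1:] - (\<chi> i j. [:A $ i $ j:]))"

text \<open>
  \<open>-Tr (\<rho> log \<rho>)\<close>, i.e. the sum of \<open>-x log x\<close> over the eigenvalues \<open>x\<close> of \<open>\<rho>\<close> with
  multiplicity. For a density matrix the eigenvalues are real, so \<^const>\<open>Re\<close> only changes the
  type; the summand vanishes at \<open>x = 0\<close>.
\<close>
definition vn_entropy :: "complex ^ 'n ^ 'n \<Rightarrow> real" where
  "vn_entropy \<rho> = - (\<Sum>x\<in>#proots (charpoly \<rho>). Re x * log 2 (Re x))"


section \<open>Discord\<close>

text \<open>The projectors may have arbitrary rank.\<close>
definition projective_measurement :: "(complex ^ 'n ^ 'n) set \<Rightarrow> bool" where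
  "projective_measurement M \<longleftrightarrow>
     finite M \<and>
     (\<forall>P\<in>M. conj_transpose P = P \<and> P ** P = P) \<and>
     (\<forall>P\<in>M. \<forall>Q\<in>M. P \<noteq> Q \<longrightarrow> P ** Q = 0) \<and>
     (\<Sum>P\<in>M. P) = mat 1"

definition outcome_prob ::
  "complex ^ ('m::finite \<times> 'n::finite) ^ ('m \<times> 'n) \<Rightarrow> complex ^ 'n ^ 'n \<Rightarrow> real" where
  "outcome_prob \<rho> P = Re (trace (kron (mat 1) P ** \<rho>))"

definition post_state ::
  "complex ^ ('m::finite \<times> 'n::finite) ^ ('m \<times> 'n) \<Rightarrow> complex ^ 'n ^ 'n \<Rightarrow> complex ^ 'm ^ 'm" where
  "post_state \<rho> P =
     (1 / outcome_prob \<rho> P) *\<^sub>R ptrace_snd (kron (mat 1) P ** \<rho> ** kron (mat 1) P)"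

definition discord_wrt ::
  "complex ^ ('m::finite \<times> 'n::finite) ^ ('m \<times> 'n) \<Rightarrow> (complex ^ 'n ^ 'n) set \<Rightarrow> real" where
  "discord_wrt \<rho> M =
     vn_entropy (ptrace_fst \<rho>) - vn_entropy \<rho> +
     (\<Sum>P\<in>{P\<in>M. outcome_prob \<rho> P \<noteq> 0}. outcome_prob \<rho> P * vn_entropy (post_state \<rho> P))"

definition discord :: "complex ^ ('m::finite \<times> 'n::finite) ^ ('m \<times> 'n) \<Rightarrow> real" where
  "discord \<rho> = Inf (discord_wrt \<rho> ` Collect projective_measurement)"


section \<open>Subgroups and characters\<close>

definition is_subgroup :: "'g::ab_group_add set \<Rightarrow> bool" where
  "is_subgroup H \<longleftrightarrow> 0 \<in> H \<and> (\<forall>x\<in>H. \<forall>y\<in>H. x + y \<in> H) \<and> (\<forall>x\<in>H. - x \<in> H)"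

definition characters :: "('g::ab_group_add \<Rightarrow> complex) set" where
  "characters = {\<phi>. (\<forall>g. cmod (\<phi> g) = 1) \<and> (\<forall>g h. \<phi> (g + h) = \<phi> g * \<phi> h)}"

definition annihilator :: "'g::ab_group_add set \<Rightarrow> ('g \<Rightarrow> complex) set" where
  "annihilator H = {\<phi>\<in>characters. \<forall>h\<in>H. \<phi> h = 1}"

definition char_vec :: "('g::finite \<Rightarrow> complex) \<Rightarrow> complex ^ 'g" where
  "char_vec \<phi> = (1 / sqrt (real CARD('g))) *\<^sub>R (\<Sum>g\<in>UNIV. cnj (\<phi> g) *s axis g 1)"


section \<open>The hidden subgroup problem\<close>

definition hides :: "('g::ab_group_add \<Rightarrow> 'x) \<Rightarrow> 'g set \<Rightarrow> bool" where
  "hides f H \<longleftrightarrow> is_subgroup H \<and> (\<forall>g g'. f g = f g' \<longleftrightarrow> g - g' \<in> H)"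

text \<open>
  Throughout, \<open>F\<close> is the set of oracles, \<open>p\<close> their distribution, and \<open>H\<close> the family of candidate
  subgroups, indexed by a finite type.
\<close>
definition hsp_class ::
  "('g::ab_group_add \<Rightarrow> 'x) set \<Rightarrow> ('j \<Rightarrow> 'g set) \<Rightarrow> 'j \<Rightarrow> ('g \<Rightarrow> 'x) set" where
  "hsp_class F H j = {f\<in>F. hides f (H j)}"

definition class_prob ::
  "('g::ab_group_add \<Rightarrow> 'x) set \<Rightarrow> (('g \<Rightarrow> 'x) \<Rightarrow> real) \<Rightarrow> ('j \<Rightarrow> 'g set) \<Rightarrow> 'j \<Rightarrow> real" where
  "class_prob F p H j = (\<Sum>f\<in>hsp_class F H j. p f)"

text \<open>
  The output set \<open>'x\<close> may be infinite, so vectors and operators on the joint register are given by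
  their coordinates with respect to the basis \<open>|g\<rangle> \<otimes> |x\<rangle>\<close>. All sums over \<open>'x\<close> below have
  finitely many nonzero terms.
\<close>
definition ket :: "'a \<Rightarrow> 'a \<Rightarrow> complex" where
  "ket a b = (if b = a then 1 else 0)"

definition post_query_state :: "('g::finite \<Rightarrow> 'x) \<Rightarrow> 'g \<times> 'x \<Rightarrow> complex" where
  "post_query_state f =
     (\<lambda>(h, x). complex_of_real (1 / sqrt (real CARD('g))) * (\<Sum>g\<in>UNIV. ket g h * ket (f g) x))"

definition ptrace_output ::
  "('g::finite \<times> 'x \<Rightarrow> 'g \<times> 'x \<Rightarrow> complex) \<Rightarrow> complex ^ 'g ^ 'g" where
  "ptrace_output K = (\<chi> g h. \<Sum>\<^sub>\<infinity>x. K (g, x) (h, x))"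

definition class_state ::
  "('g::{finite, ab_group_add} \<Rightarrow> 'x) set \<Rightarrow> (('g \<Rightarrow> 'x) \<Rightarrow> real) \<Rightarrow> ('j \<Rightarrow> 'g set) \<Rightarrow> 'j
     \<Rightarrow> complex ^ 'g::{finite, ab_group_add} ^ 'g::{finite, ab_group_add}" where
  "class_state F p H j =
     (1 / class_prob F p H j) *\<^sub>R
       (\<Sum>f\<in>hsp_class F H j.
          p f *\<^sub>R ptrace_output (\<lambda>r s. post_query_state f r * cnj (post_query_state f s)))"

definition input_state ::
  "('g::{finite, ab_group_add} \<Rightarrow> 'x) set \<Rightarrow> (('g \<Rightarrow> 'x) \<Rightarrow> real) \<Rightarrow> ('j::finite \<Rightarrow> 'g set)
     \<Rightarrow> complex ^ 'g::{finite, ab_group_add} ^ 'g::{finite, ab_group_add}" where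
  "input_state F p H = (\<Sum>j\<in>UNIV. class_prob F p H j *\<^sub>R class_state F p H j)"

definition joint_state ::
  "('g::{finite, ab_group_add} \<Rightarrow> 'x) set \<Rightarrow> (('g \<Rightarrow> 'x) \<Rightarrow> real) \<Rightarrow> ('j::finite \<Rightarrow> 'g set)
     \<Rightarrow> complex ^ ('j \<times> 'g) ^ ('j \<times> 'g)" where
  "joint_state F p H =
     (\<Sum>j\<in>UNIV. class_prob F p H j *\<^sub>R kron (ketbra (axis j 1) (axis j 1)) (class_state F p H j))"

definition eig_val ::
  "('g::{finite, ab_group_add} \<Rightarrow> 'x) set \<Rightarrow> (('g \<Rightarrow> 'x) \<Rightarrow> real) \<Rightarrow> ('j::finite \<Rightarrow> 'g set)
     \<Rightarrow> ('g \<Rightarrow> complex) \<Rightarrow> real" where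
  "eig_val F p H \<phi> =
     1 / real CARD('g) *
       (\<Sum>j\<in>{j. \<phi> \<in> annihilator (H j)}. class_prob F p H j * real (card (H j)))"

definition count_vec :: "('j::finite \<Rightarrow> 'g::finite set) \<Rightarrow> complex ^ 'g" where
  "count_vec H = (\<Sum>g\<in>UNIV. of_nat (card {j. g \<in> H j}) *s axis g 1)"

end

theory Submission
  imports Defs
begin

text \<open>
  Only \<open>f g = f h \<longleftrightarrow> g - h \<in> H j\<close> matters for the traced-out state, so \<open>\<sigma>\<^sub>j\<close> has entries
  \<open>1 / |G|\<close> where \<open>g - h \<in> H j\<close> and \<open>0\<close> elsewhere. Its diagonal is constant, hence \<open>Y\<^sub>2\<close> is uniform
  given any \<open>J\<close>. It commutes with translations, hence is diagonal in the character basis, and (c)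
  to (e) are computations with \<open>\<Sum>k\<in>H j. \<chi> k\<close>. In that basis the joint state is the classical
  distribution \<open>p\<^sub>j \<lambda>\<^bsub>j,\<chi>\<^esub>\<close>; measuring \<open>Y\<close> processes \<open>\<chi>\<close> through a classical channel, so the log sum
  inequality makes the discord nonnegative, and measuring in the character basis itself loses nothing.
\<close>

section \<open>Orthonormal eigenbases and entropy\<close>

lemma conj_transpose_nth [simp]: "conj_transpose A $ i $ j = cnj (A $ j $ i)"
  by (simp add: conj_transpose_def)

lemma braket_scaleC_right: "braket v (c *s w) = c * braket v w"
  by (simp add: braket_def sum_distrib_left algebra_simps)

lemma braket_adjoint: "braket v (A *v w) = braket (conj_transpose A *v v) w"
  unfolding braket_def matrix_vector_mult_def
  by (simp add: sum_distrib_left sum_distrib_right, subst sum.swap) (simp add: algebra_simps)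

lemma braket_self: "braket v v = of_real (\<Sum>i\<in>UNIV. (cmod (v $ i))\<^sup>2)"
  by (simp add: braket_def complex_norm_square mult.commute del: of_real_power)

lemma braket_axis_left: "braket (axis i 1) v = v $ i"
  by (simp add: braket_def axis_def if_distrib[of cnj] mult_delta_left cong: if_cong)

definition orthonormal_on :: "'i set \<Rightarrow> ('i \<Rightarrow> complex ^ 'n) \<Rightarrow> bool" where
  "orthonormal_on B b \<longleftrightarrow> (\<forall>i\<in>B. \<forall>j\<in>B. braket (b i) (b j) = (if i = j then 1 else 0))"

text \<open>Spanning is encoded by the count of orthonormal vectors. The index set is free, so that
  characters or pairs can label them.\<close>

definition orthonormal_basis_on :: "'i set \<Rightarrow> ('i \<Rightarrow> complex ^ 'n) \<Rightarrow> bool" where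
  "orthonormal_basis_on B b \<longleftrightarrow> finite B \<and> card B = CARD('n) \<and> orthonormal_on B b"

text \<open>With the vectors as columns of a square matrix U, orthonormality says U* U = 1, and a
  one-sided inverse of a square matrix is two-sided.\<close>

lemma orthonormal_basis_matrix:
  fixes b :: "'i \<Rightarrow> complex ^ 'n"
  assumes "orthonormal_basis_on B b"
  obtains e where "bij_betw e (UNIV :: 'n set) B"
    and "conj_transpose (\<chi> a i. b (e i) $ a) ** (\<chi> a i. b (e i) $ a) = mat 1"
    and "(\<chi> a i. b (e i) $ a) ** conj_transpose (\<chi> a i. b (e i) $ a) = mat 1"
proof -
  obtain e where e: "bij_betw e (UNIV :: 'n set) B"
    using assms finite_same_card_bij[of "UNIV :: 'n set" B]
    by (auto simp: orthonormal_basis_on_def)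
  have "e i \<in> B" for i
    using e by (auto simp: bij_betw_def)
  moreover have "inj e"
    using e by (auto simp: bij_betw_def)
  ultimately have on: "braket (b (e i)) (b (e j)) = (if i = j then 1 else 0)" for i j
    using assms by (auto simp: orthonormal_basis_on_def orthonormal_on_def dest: injD)
  have left: "conj_transpose (\<chi> a i. b (e i) $ a) ** (\<chi> a i. b (e i) $ a) = mat 1"
    using on by (simp add: vec_eq_iff matrix_matrix_mult_def mat_def braket_def)
  then show thesis
    using matrix_left_right_inverse[THEN iffD1] by (intro that[OF e]) auto
qed

lemma orthonormal_basis_completeness:
  fixes b :: "'i \<Rightarrow> complex ^ 'n"
  assumes "orthonormal_basis_on B b"
  shows "(\<Sum>i\<in>B. b i $ a * cnj (b i $ c)) = (if a = c then 1 else 0)"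
proof -
  obtain e where e: "bij_betw e (UNIV :: 'n set) B"
    and u: "(\<chi> a i. b (e i) $ a) ** conj_transpose (\<chi> a i. b (e i) $ a) = mat 1"
    using orthonormal_basis_matrix[OF assms] by metis
  have "(\<Sum>i\<in>B. b i $ a * cnj (b i $ c)) = (\<Sum>i\<in>UNIV. b (e i) $ a * cnj (b (e i) $ c))"
    using sum.reindex_bij_betw[OF e, of "\<lambda>i. b i $ a * cnj (b i $ c)"] by simp
  also have "\<dots> = ((\<chi> a i. b (e i) $ a) ** conj_transpose (\<chi> a i. b (e i) $ a)) $ a $ c"
    by (simp add: matrix_matrix_mult_def)
  also have "\<dots> = (if a = c then 1 else 0)"
    by (simp add: u mat_def)
  finally show ?thesis .
qed

lemma trace_eq_sum_braket:
  fixes b :: "'i \<Rightarrow> complex ^ 'n"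
  assumes "orthonormal_basis_on B b"
  shows "trace A = (\<Sum>i\<in>B. braket (b i) (A *v b i))"
proof -
  have "(\<Sum>i\<in>B. braket (b i) (A *v b i)) =
      (\<Sum>i\<in>B. \<Sum>a\<in>UNIV. \<Sum>c\<in>UNIV. A $ a $ c * (b i $ c * cnj (b i $ a)))"
    by (simp add: braket_def matrix_vector_mult_def sum_distrib_left algebra_simps)
  also have "\<dots> = (\<Sum>a\<in>UNIV. \<Sum>c\<in>UNIV. \<Sum>i\<in>B. A $ a $ c * (b i $ c * cnj (b i $ a)))"
    by (subst sum.swap, rule sum.cong[OF refl], subst sum.swap) simp
  also have "\<dots> = (\<Sum>a\<in>UNIV. \<Sum>c\<in>UNIV. A $ a $ c * (if c = a then 1 else 0))"
    by (simp flip: sum_distrib_left add: orthonormal_basis_completeness[OF assms])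
  also have "\<dots> = trace A"
    by (simp add: trace_def if_distrib cong: if_cong)
  finally show ?thesis ..
qed

section \<open>Spectrum and entropy in an eigenbasis\<close>

lemma poly_charpoly: "poly (charpoly A) x = det (mat x - A)"
proof -
  have "poly ((mat [:0, 1:] - (\<chi> i j. [:A $ i $ j:])) $ i $ j) x = (mat x - A) $ i $ j" for i j
    by (simp add: mat_def)
  then show ?thesis
    by (simp add: charpoly_def det_def poly_sum poly_prod)
qed

text \<open>The eigenvector matrix \<open>U\<close> is invertible and conjugates \<open>A\<close> to
  a diagonal matrix, so both sides agree at every point; complex polynomials that agree everywhere
  are equal.\<close>

lemma charpoly_eigenbasis:
  fixes b :: "'i \<Rightarrow> complex ^ 'n"
  assumes "orthonormal_basis_on B b"
    and eig: "\<And>i. i \<in> B \<Longrightarrow> A *v b i = l i *s b i"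
  shows "charpoly A = (\<Prod>i\<in>B. [:- l i, 1:])"
proof -
  obtain e where e: "bij_betw e (UNIV :: 'n set) B"
    and u: "conj_transpose (\<chi> a i. b (e i) $ a) ** (\<chi> a i. b (e i) $ a) = mat 1"
    using orthonormal_basis_matrix[OF assms(1)] by metis
  define U where "U = (\<chi> a i. b (e i) $ a)"
  have "det (conj_transpose U) * det U = 1"
    using u by (simp flip: det_mul U_def)
  then have U: "det U \<noteq> 0"
    by auto
  have eB: "e i \<in> B" for i
    using e by (auto simp: bij_betw_def)
  have "poly (charpoly A) x = poly (\<Prod>i\<in>B. [:- l i, 1:]) x" for x
  proof -
    \<comment> \<open>\<open>D\<close> is already shifted: it represents x - A in the eigenbasis,
      not \<open>A\<close>.\<close>
    define D :: "complex ^ 'n ^ 'n" where "D = (\<chi> i j. if i = j then x - l (e i) else 0)"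
    have AU: "(A ** U) $ a $ i = l (e i) * U $ a $ i" for a i
      using eig[OF eB, of i]
      by (simp add: matrix_matrix_mult_def U_def vec_eq_iff matrix_vector_mult_def)
    have "(mat x - A) ** U = mat x ** U - A ** U"
      by (simp add: matrix_matrix_mult_def vec_eq_iff sum_subtractf algebra_simps)
    also have "\<dots> = U ** D"
      by (simp add: vec_eq_iff AU)
        (simp add: matrix_matrix_mult_def mat_def D_def if_distrib if_distribR algebra_simps cong: if_cong)
    finally have "det (mat x - A) * det U = det U * det D"
      by (metis det_mul)
    then have "poly (charpoly A) x = det D"
      using U by (simp add: poly_charpoly)
    also have "\<dots> = (\<Prod>i\<in>UNIV. x - l (e i))"
      by (subst det_diagonal) (simp_all add: D_def)
    also have "\<dots> = poly (\<Prod>i\<in>B. [:- l i, 1:]) x"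
      using prod.reindex_bij_betw[OF e, of "\<lambda>i. x - l i"] by (simp add: poly_prod)
    finally show ?thesis .
  qed
  then show ?thesis
    by (simp add: fun_eq_iff flip: poly_eq_poly_eq_iff)
qed

text \<open>The linear factors of the characteristic polynomial list the roots with multiplicity, so
  the sum over roots becomes one over basis labels.\<close>

lemma vn_entropy_eigenbasis:
  fixes b :: "'i \<Rightarrow> complex ^ 'n" and l :: "'i \<Rightarrow> real"
  assumes B: "orthonormal_basis_on B b"
    and eig: "\<And>i. i \<in> B \<Longrightarrow> A *v b i = of_real (l i) *s b i"
  shows "vn_entropy A = - (\<Sum>i\<in>B. l i * log 2 (l i))"
proof -
  have "finite B"
    using B by (simp add: orthonormal_basis_on_def)
  then have "proots (\<Prod>i\<in>B. [:- complex_of_real (l i), 1:]) = (\<Sum>i\<in>B. {#complex_of_real (l i)#})"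
    by (subst proots_prod) auto
  then have "proots (charpoly A) = image_mset (\<lambda>i. complex_of_real (l i)) (mset_set B)"
    by (simp add: charpoly_eigenbasis[OF B eig] sum_unfold_sum_mset)
  then show ?thesis
    by (simp add: vn_entropy_def sum_unfold_sum_mset image_mset.compositionality o_def)
qed

lemma orthonormal_basis_axis: "orthonormal_basis_on UNIV (\<lambda>i :: 'n :: finite. axis i 1)"
  by (simp add: orthonormal_basis_on_def orthonormal_on_def braket_axis_left) (simp add: axis_def)

section \<open>Characters of a finite abelian group\<close>

text \<open>The summands are powers \<open>z ^ m\<close> of one root of unity. For \<open>k\<close>
  nonzero, \<open>z\<close> is not 1, as \<open>n\<close> cannot divide a positive \<open>k\<close>
  below it, and the geometric sum is 0.\<close>

lemma sum_roots_of_unity_powers: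
  assumes "0 < n" and "k < n"
  shows "(\<Sum>m<n. cis (2 * pi * of_nat m / of_nat n) ^ k) = (if k = 0 then of_nat n else 0)"
proof (cases "k = 0")
  case False
  define z where "z = cis (2 * pi * of_nat k / of_nat n)"
  have "cis (2 * pi * of_nat m / of_nat n) ^ k = z ^ m" for m
    unfolding z_def Complex.DeMoivre by (simp add: mult_ac)
  moreover have "z ^ n = 1"
    using assms cis_multiple_2pi[of "real k"] unfolding z_def Complex.DeMoivre by (simp add: mult_ac)
  moreover have "z \<noteq> 1"
  proof
    assume "z = 1"
    then have "cos (2 * pi * of_nat k / of_nat n) = 1"
      by (simp add: z_def complex_eq_iff)
    then obtain i :: int where "2 * pi * of_nat k / of_nat n = of_int i * 2 * pi"
      by (auto simp: cos_one_2pi_int)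
    then have "real k = of_int i * real n"
      using assms by (simp add: field_simps)
    then have "int k = i * int n"
      by (metis of_int_eq_iff of_int_mult of_int_of_nat_eq)
    then have "int n dvd int k"
      by simp
    then show False
      using assms False by (auto dest: dvd_imp_le)
  qed
  ultimately show ?thesis
    using False by (simp add: geometric_sum)
qed simp

text \<open>
  Translations have finite order, so averaging over the powers of one of them splits any vector
  into eigenvectors; doing this for one translation after the other keeps earlier eigenvectors.
\<close>
lemma span_joint_eigenvectors:
  fixes S :: "'g::{finite, ab_group_add} set"
  shows "vec.span {v :: complex ^ 'g::{finite, ab_group_add}. \<forall>h\<in>S. \<exists>c. \<forall>g. v $ (g + h) = c * v $ g} = UNIV"
proof (induction S rule: finite_induct[OF finite])
  case 1
  then show ?case
    by simp
next
  case (2 s S)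
  define E where "E S = {v :: complex ^ 'g::{finite, ab_group_add}. \<forall>h\<in>S. \<exists>c. \<forall>g. v $ (g + h) = c * v $ g}" for S
  have "inj ((+) s)"
    by (simp add: inj_on_def)
  \<comment> \<open>Iterating an injection of a finite set returns to the start, so some positive
    multiple \<open>n\<close> of \<open>s\<close> is 0. Below, \<open>t k\<close> is the
    \<open>k\<close>-fold sum of \<open>s\<close>.\<close>
  then obtain n where n: "n > 0" "((+) s ^^ n) 0 = 0"
    using funpow_inj_finite[of "(+) s" 0] by auto
  define t where "t k = ((+) s ^^ k) 0" for k
  have t: "t 0 = 0" "t (Suc k) = s + t k" "t n = 0" for k
    using n by (simp_all add: t_def)
  have "v \<in> vec.span (E (insert s S))" if v: "v \<in> E S" for v
  proof -
    define z where "z m = cis (2 * pi * of_nat m / of_nat n)" for m :: nat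
    have zn: "z m ^ n = 1" for m
      using n cis_multiple_2pi[of "real m"] unfolding z_def Complex.DeMoivre by (simp add: mult_ac)
    \<comment> \<open>Discrete Fourier component of \<open>v\<close> along the multiples of
      \<open>s\<close>, without the factor 1 / n; translation by \<open>s\<close> multiplies it by
      \<open>inverse (z m)\<close>.\<close>
    define w :: "nat \<Rightarrow> complex ^ 'g::{finite, ab_group_add}" where
      "w m = (\<chi> g. \<Sum>k<n. z m ^ k * v $ (g + t k))" for m
    have "w m \<in> E (insert s S)" for m
    proof -
      have "\<exists>c. \<forall>g. w m $ (g + h) = c * w m $ g" if "h \<in> S" for h
      proof -
        obtain c where "v $ (g + h) = c * v $ g" for g
          using v \<open>h \<in> S\<close> by (auto simp: E_def)
        then have "v $ (g + h + x) = c * v $ (g + x)" for g x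
          by (metis add.assoc add.commute)
        then show ?thesis
          by (intro exI[of _ c]) (simp add: w_def sum_distrib_left mult.left_commute)
      qed
      moreover have "z m * w m $ (g + s) = w m $ g" for g
      proof -
        define a where "a k = z m ^ k * v $ (g + t k)" for k
        have "z m * w m $ (g + s) = (\<Sum>k<n. a (Suc k))"
          by (simp add: w_def a_def t sum_distrib_left algebra_simps)
        \<comment> \<open>The sum is cyclic: \<open>a n = a 0\<close>, because
          \<open>z m ^ n = 1\<close> and \<open>t n = 0\<close>.\<close>
        also have "\<dots> = (\<Sum>k<n. a k)"
          using sum.lessThan_Suc_shift[of a n] by (simp add: a_def t zn)
        finally show ?thesis
          by (simp add: w_def a_def)
      qed
      then have "w m $ (g + s) = inverse (z m) * w m $ g" for g
        by (simp add: field_simps z_def)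
      ultimately show ?thesis
        by (auto simp: E_def)
    qed
    then have "(1 / of_nat n) *s (\<Sum>m<n. w m) \<in> vec.span (E (insert s S))"
      by (intro vec.span_scale vec.span_sum vec.span_base)
    moreover have "(1 / of_nat n) *s (\<Sum>m<n. w m) = v"
    proof -
      \<comment> \<open>Summing over all roots of unity leaves only the untranslated term
        \<open>k = 0\<close>.\<close>
      have "(\<Sum>m<n. w m $ g) = of_nat n * v $ g" for g
      proof -
        have "(\<Sum>m<n. w m $ g) = (\<Sum>k<n. \<Sum>m<n. z m ^ k * v $ (g + t k))"
          unfolding w_def vec_lambda_beta by (rule sum.swap)
        also have "\<dots> = (\<Sum>k<n. (if k = 0 then of_nat n else 0) * v $ (g + t k))"
          using n by (simp flip: sum_distrib_right add: z_def sum_roots_of_unity_powers)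
        also have "\<dots> = (\<Sum>k\<in>{0}. of_nat n * v $ (g + t k))"
          using n by (intro sum.mono_neutral_cong_right) auto
        finally show ?thesis
          by (simp add: t)
      qed
      then show ?thesis
        using n by (simp add: vec_eq_iff)
    qed
    ultimately show ?thesis
      by simp
  qed
  then have "vec.span (E S) \<subseteq> vec.span (E (insert s S))"
    by (intro vec.span_minimal vec.subspace_span) auto
  with 2 show ?case
    by (auto simp: E_def)
qed

section \<open>Character vectors and orthogonality relations\<close>

lemma char_vec_nth: "char_vec \<phi> $ g = cnj (\<phi> g) / of_real (sqrt (real CARD('g)))"
  for \<phi> :: "'g::finite \<Rightarrow> complex"
  by (simp add: char_vec_def axis_def mult_delta_right) (simp add: scaleR_conv_of_real divide_simps)

lemma of_real_sqrt_CARD_square: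
  "complex_of_real (sqrt (real CARD('g::finite))) * complex_of_real (sqrt (real CARD('g))) = of_nat CARD('g)"
  by (simp flip: of_real_mult)

lemma character_add: "\<phi> \<in> characters \<Longrightarrow> \<phi> (g + h) = \<phi> g * \<phi> h"
  and character_norm: "\<phi> \<in> characters \<Longrightarrow> cmod (\<phi> g) = 1"
  by (auto simp: characters_def)

lemma character_nonzero: "\<phi> \<in> characters \<Longrightarrow> \<phi> g \<noteq> 0"
  using character_norm[of \<phi> g] by auto

lemma character_zero: "\<phi> \<in> characters \<Longrightarrow> \<phi> 0 = 1"
  using character_add[of \<phi> 0 0] character_nonzero[of \<phi> 0] by simp

lemma character_cnj_mult: "\<phi> \<in> characters \<Longrightarrow> \<phi> g * cnj (\<phi> g) = 1"
  by (simp add: character_norm flip: complex_norm_square)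

lemma character_diff: "\<phi> \<in> characters \<Longrightarrow> \<phi> (g - h) = \<phi> g * cnj (\<phi> h)"
  using character_add[of \<phi> "g - h" h] character_cnj_mult[of \<phi> h]
  by (simp add: algebra_simps)

lemma is_subgroup_diff: "is_subgroup K \<Longrightarrow> x \<in> K \<Longrightarrow> y \<in> K \<Longrightarrow> x - y \<in> K"
  unfolding is_subgroup_def diff_conv_add_uminus by blast

text \<open>If \<open>\<phi> h\<close> differs from 1 for some \<open>h\<close> in \<open>K\<close>,
  translation by \<open>h\<close> multiplies the sum by \<open>\<phi> h\<close> without changing it,
  so it is 0.\<close>

lemma sum_character_subgroup:
  fixes \<phi> :: "'g::{finite, ab_group_add} \<Rightarrow> complex"
  assumes "is_subgroup K" and "\<phi> \<in> characters"
  shows "(\<Sum>g\<in>K. \<phi> g) = (if \<phi> \<in> annihilator K then of_nat (card K) else 0)"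
proof (cases "\<phi> \<in> annihilator K")
  case True
  then show ?thesis
    by (simp add: annihilator_def)
next
  case False
  then obtain h where h: "h \<in> K" "\<phi> h \<noteq> 1"
    using assms by (auto simp: annihilator_def)
  have "bij_betw (\<lambda>g. h + g) K K"
    using assms h is_subgroup_diff[OF assms(1)]
    by (intro bij_betwI[where g = "\<lambda>g. g - h"]) (auto simp: is_subgroup_def)
  then have "(\<Sum>g\<in>K. \<phi> g) = (\<Sum>g\<in>K. \<phi> (h + g))"
    by (simp add: sum.reindex_bij_betw)
  also have "\<dots> = \<phi> h * (\<Sum>g\<in>K. \<phi> g)"
    using assms by (simp add: character_add sum_distrib_left)
  finally show ?thesis
    using h False by simp
qed

text \<open>Up to the factor 1 / |G| this is the group sum of the character
  \<open>\<phi> g * cnj (\<psi> g)\<close>, which is trivial exactly when the two agree.\<close>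

lemma braket_char_vec:
  fixes \<phi> \<psi> :: "'g::{finite, ab_group_add} \<Rightarrow> complex"
  assumes "\<phi> \<in> characters" and "\<psi> \<in> characters"
  shows "braket (char_vec \<phi>) (char_vec \<psi>) = (if \<phi> = \<psi> then 1 else 0)"
proof -
  have chi: "(\<lambda>g. \<phi> g * cnj (\<psi> g)) \<in> characters"
    using assms by (auto simp: characters_def norm_mult)
  have "(\<lambda>g. \<phi> g * cnj (\<psi> g)) \<in> annihilator UNIV \<longleftrightarrow> \<phi> = \<psi>"
  proof
    assume "(\<lambda>g. \<phi> g * cnj (\<psi> g)) \<in> annihilator UNIV"
    then have "\<phi> g * cnj (\<psi> g) = \<psi> g * cnj (\<psi> g)" for g
      using assms by (simp add: annihilator_def character_cnj_mult)
    then show "\<phi> = \<psi>"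
      using character_nonzero[OF assms(2)] by auto
  next
    assume "\<phi> = \<psi>"
    with chi show "(\<lambda>g. \<phi> g * cnj (\<psi> g)) \<in> annihilator UNIV"
      using assms by (simp add: annihilator_def character_cnj_mult)
  qed
  moreover have "is_subgroup (UNIV :: 'g set)"
    by (simp add: is_subgroup_def)
  moreover have "braket (char_vec \<phi>) (char_vec \<psi>) =
      (\<Sum>g\<in>UNIV. \<phi> g * cnj (\<psi> g)) / of_nat CARD('g)"
    by (simp add: braket_def char_vec_nth of_real_sqrt_CARD_square sum_divide_distrib)
  ultimately show ?thesis
    using chi by (simp add: sum_character_subgroup)
qed

text \<open>A nonzero \<open>v\<close> is fixed by its value at 0, and its translation eigenvalues
  \<open>c\<close> multiply under addition, so they form a character.\<close>

lemma joint_eigenvector_in_span_char_vec: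
  fixes v :: "complex ^ 'g::{finite, ab_group_add}"
  assumes "\<And>h. \<exists>c. \<forall>g. v $ (g + h) = c * v $ g"
  shows "v \<in> vec.span (char_vec ` characters)"
proof (cases "v = 0")
  case True
  then show ?thesis
    by (simp add: vec.span_zero)
next
  case False
  obtain c where c: "v $ (g + h) = c h * v $ g" for g h
    using assms by metis
  have v: "v $ h = c h * v $ 0" for h
    using c[of 0 h] by simp
  have v0: "v $ 0 \<noteq> 0"
    using False v unfolding vec_eq_iff by (metis mult_zero_right zero_index)
  have "c (g + h) * v $ 0 = c g * c h * v $ 0" for g h
    using c[of g h] v[of g] v[of "g + h"] by (simp add: algebra_simps)
  then have hom: "c (g + h) = c g * c h" for g h
    using v0 by simp
  have "cmod (c h) = 1" for h
  proof -
    \<comment> \<open>Translation permutes the entries of \<open>v\<close>, so the positive sum of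
      their moduli is unchanged when scaled by \<open>cmod (c h)\<close>.\<close>
    have "bij_betw (\<lambda>g. g + h) UNIV UNIV"
      by (intro bij_betwI[where g = "\<lambda>g. g - h"]) auto
    then have "(\<Sum>g\<in>UNIV. cmod (v $ g)) = (\<Sum>g\<in>UNIV. cmod (v $ (g + h)))"
      by (rule sum.reindex_bij_betw[symmetric])
    also have "\<dots> = cmod (c h) * (\<Sum>g\<in>UNIV. cmod (v $ g))"
      by (simp add: c norm_mult sum_distrib_left)
    finally have "(\<Sum>g\<in>UNIV. cmod (v $ g)) = cmod (c h) * (\<Sum>g\<in>UNIV. cmod (v $ g))" .
    moreover have "(\<Sum>g\<in>UNIV. cmod (v $ g)) > 0"
      using v0 by (intro sum_pos2[where i = 0]) auto
    ultimately show ?thesis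
      by simp
  qed
  with hom have "(\<lambda>g. cnj (c g)) \<in> characters"
    by (simp add: characters_def)
  moreover have "v = (of_real (sqrt (real CARD('g))) * v $ 0) *s char_vec (\<lambda>g. cnj (c g))"
    unfolding vec_eq_iff by (intro allI, subst v) (simp add: char_vec_nth)
  ultimately show ?thesis
    by (metis imageI vec.span_base vec.span_scale)
qed

lemma span_char_vec:
  "vec.span (char_vec ` characters) = (UNIV :: (complex ^ 'g::{finite, ab_group_add}) set)"
proof -
  have "vec.span {v :: complex ^ 'g::{finite, ab_group_add}. \<forall>h\<in>UNIV. \<exists>c. \<forall>g. v $ (g + h) = c * v $ g}
      \<subseteq> vec.span (char_vec ` characters)"
    by (intro vec.span_minimal vec.subspace_span) (auto intro: joint_eigenvector_in_span_char_vec)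
  then show ?thesis
    by (simp only: span_joint_eigenvectors) auto
qed

lemma inj_on_char_vec: "inj_on (char_vec :: ('g::{finite, ab_group_add} \<Rightarrow> complex) \<Rightarrow> _) characters"
proof (rule inj_onI)
  fix \<phi> \<psi> :: "'g \<Rightarrow> complex"
  assume "\<phi> \<in> characters" "\<psi> \<in> characters" "char_vec \<phi> = char_vec \<psi>"
  then show "\<phi> = \<psi>"
    using braket_char_vec[of \<phi> \<psi>] braket_char_vec[of \<psi> \<psi>] by (simp split: if_splits)
qed

lemma independent_char_vec:
  "vec.independent (char_vec ` (characters :: ('g::{finite, ab_group_add} \<Rightarrow> complex) set))"
proof
  assume "vec.dependent (char_vec ` (characters :: ('g \<Rightarrow> complex) set))"
  then obtain T u v where T: "finite T" "T \<subseteq> char_vec ` (characters :: ('g \<Rightarrow> complex) set)"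
      and v: "v \<in> T" "u v \<noteq> 0" and z: "(\<Sum>w\<in>T. u w *s w) = 0"
    by (auto simp: vec.dependent_explicit)
  have on: "braket v w = (if w = v then 1 else 0)" if "w \<in> T" for w
  proof -
    obtain \<phi> \<psi> where "v = char_vec \<phi>" "\<phi> \<in> characters" "w = char_vec \<psi>" "\<psi> \<in> characters"
      using T v \<open>w \<in> T\<close> by blast
    then show ?thesis
      using inj_on_char_vec by (auto simp: braket_char_vec dest: inj_onD)
  qed
  have "0 = braket v (\<Sum>w\<in>T. u w *s w)"
    by (simp add: z braket_def)
  also have "\<dots> = (\<Sum>w\<in>T. u w * braket v w)"
    by (simp add: braket_def sum_distrib_left sum.swap[of _ UNIV T] algebra_simps)
  also have "\<dots> = u v"
    using T v by (simp add: on if_distrib sum.delta' cong: sum.cong if_cong)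
  finally show False
    using v by simp
qed

text \<open>An independent spanning family has as many members as the dimension, so there are
  exactly |G| characters.\<close>

lemma orthonormal_basis_char_vec:
  "orthonormal_basis_on characters (char_vec :: ('g::{finite, ab_group_add} \<Rightarrow> complex) \<Rightarrow> _)"
proof -
  let ?C = "characters :: ('g \<Rightarrow> complex) set"
  have "finite (char_vec ` ?C)"
    using independent_char_vec by (rule vec.finiteI_independent)
  then have "finite ?C"
    using inj_on_char_vec by (rule finite_imageD)
  moreover have "card (char_vec ` ?C) = vec.dim (UNIV :: (complex ^ 'g::{finite, ab_group_add}) set)"
    using independent_char_vec span_char_vec by (intro vec.dim_eq_card[symmetric]) auto
  then have "card ?C = CARD('g)"
    by (simp add: card_image[OF inj_on_char_vec] card_cart_basis)
  ultimately show ?thesis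
    by (simp add: orthonormal_basis_on_def orthonormal_on_def braket_char_vec)
qed

lemma finite_characters: "finite (characters :: ('g::{finite, ab_group_add} \<Rightarrow> complex) set)"
  using orthonormal_basis_char_vec unfolding orthonormal_basis_on_def by blast

text \<open>The dual orthogonality relation: completeness of the character basis at the entry
  \<open>(0, g)\<close>, since all vectors share the same coordinate at 0.\<close>

lemma sum_characters_at:
  fixes g :: "'g::{finite, ab_group_add}"
  shows "(\<Sum>\<phi>\<in>characters. \<phi> g) = (if g = 0 then of_nat CARD('g) else 0)"
proof -
  have "(\<Sum>\<phi>\<in>characters. \<phi> g) =
      of_nat CARD('g) * (\<Sum>\<phi>\<in>characters. char_vec \<phi> $ 0 * cnj (char_vec \<phi> $ g))"
    by (simp add: char_vec_nth character_zero of_real_sqrt_CARD_square flip: sum_divide_distrib)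
  then show ?thesis
    by (simp add: orthonormal_basis_completeness[OF orthonormal_basis_char_vec])
qed

text \<open>Double counting of the sum of \<open>\<phi> g\<close> over characters and
  \<open>K\<close>: summing over \<open>K\<close> first keeps the annihilator, over characters first
  only \<open>g = 0\<close>.\<close>

lemma card_annihilator:
  fixes K :: "'g::{finite, ab_group_add} set"
  assumes "is_subgroup K"
  shows "card (annihilator K) * card K = CARD('g)"
proof -
  have "annihilator K \<subseteq> characters"
    by (auto simp: annihilator_def)
  then have "of_nat (card (annihilator K) * card K) =
      (\<Sum>\<phi>\<in>characters. if \<phi> \<in> annihilator K then of_nat (card K) else (0 :: complex))"
    by (simp add: sum.If_cases finite_characters Int_absorb1)
  also have "\<dots> = (\<Sum>\<phi>\<in>characters. \<Sum>g\<in>K. \<phi> g)"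
    using assms by (simp add: sum_character_subgroup)
  also have "\<dots> = (\<Sum>g\<in>K. \<Sum>\<phi>\<in>characters. \<phi> g)"
    by (rule sum.swap)
  also have "\<dots> = (\<Sum>g\<in>{0::'g}. of_nat CARD('g))"
    using assms by (intro sum.mono_neutral_cong_right)
      (auto simp: sum_characters_at is_subgroup_def)
  finally have "complex_of_nat (card (annihilator K) * card K) = of_nat CARD('g)"
    by simp
  then show ?thesis
    by (simp only: of_nat_eq_iff)
qed

section \<open>The log sum inequality\<close>

text \<open>Where \<open>a i\<close> is positive, ln x \<le> x - 1 at x = (A / B) / (a i / b i)
  bounds the term by \<open>A / B * b i - a i\<close>; this bound also holds at
  \<open>a i = 0\<close>, and these bounds sum to 0.\<close>

lemma log_sum_inequality:
  fixes a b :: "'i \<Rightarrow> real"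
  assumes "finite I" and a: "\<And>i. i \<in> I \<Longrightarrow> 0 \<le> a i" and b: "\<And>i. i \<in> I \<Longrightarrow> 0 \<le> b i"
    and ac: "\<And>i. i \<in> I \<Longrightarrow> b i = 0 \<Longrightarrow> a i = 0"
  shows "(\<Sum>i\<in>I. a i) * log 2 ((\<Sum>i\<in>I. a i) / (\<Sum>i\<in>I. b i)) \<le> (\<Sum>i\<in>I. a i * log 2 (a i / b i))"
proof -
  define A B where "A = (\<Sum>i\<in>I. a i)" and "B = (\<Sum>i\<in>I. b i)"
  have "A \<ge> 0" "B \<ge> 0"
    using a b by (auto simp: A_def B_def intro: sum_nonneg)
  show ?thesis
  proof (cases "A = 0")
    case True
    then have "a i = 0" if "i \<in> I" for i
      using that a \<open>finite I\<close> by (simp add: A_def sum_nonneg_eq_0_iff)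
    then show ?thesis
      by simp
  next
    case False
    with \<open>A \<ge> 0\<close> have "A > 0"
      by simp
    have "B \<noteq> 0"
    proof
      assume "B = 0"
      then have "a i = 0" if "i \<in> I" for i
        using that b ac \<open>finite I\<close> by (simp add: B_def sum_nonneg_eq_0_iff)
      with \<open>A > 0\<close> show False
        by (simp add: A_def)
    qed
    with \<open>B \<ge> 0\<close> have "B > 0"
      by simp
    have "a i * (ln (A / B) - ln (a i / b i)) \<le> A / B * b i - a i" if "i \<in> I" for i
    proof (cases "a i = 0")
      case True
      then show ?thesis
        using b[OF that] \<open>A > 0\<close> \<open>B > 0\<close> by simp
    next
      case False
      then have ab: "a i > 0" "b i > 0"
        using a[OF that] b[OF that] ac[OF that] by fastforce+
      have "ln (A / B) - ln (a i / b i) = ln (A / B / (a i / b i))"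
        using ab \<open>A > 0\<close> \<open>B > 0\<close> by (simp add: ln_div ln_mult)
      also have "\<dots> \<le> A / B / (a i / b i) - 1"
        using ab \<open>A > 0\<close> \<open>B > 0\<close> by (intro ln_le_minus_one) simp
      finally have "a i * (ln (A / B) - ln (a i / b i)) \<le> a i * (A / B / (a i / b i) - 1)"
        using ab by (intro mult_left_mono) auto
      also have "\<dots> = A / B * b i - a i"
        using ab by (simp add: field_simps)
      finally show ?thesis .
    qed
    then have "(\<Sum>i\<in>I. a i * (ln (A / B) - ln (a i / b i))) \<le> (\<Sum>i\<in>I. A / B * b i - a i)"
      by (rule sum_mono)
    also have "\<dots> = 0"
      using \<open>B > 0\<close> by (simp only: sum_subtractf flip: sum_distrib_left A_def B_def) simp
    finally have "A * ln (A / B) \<le> (\<Sum>i\<in>I. a i * ln (a i / b i))"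
      by (simp add: right_diff_distrib sum_subtractf flip: sum_distrib_right A_def)
    then have "A * ln (A / B) / ln 2 \<le> (\<Sum>i\<in>I. a i * ln (a i / b i)) / ln 2"
      by (intro divide_right_mono) auto
    then show ?thesis
      by (simp add: log_def sum_divide_distrib flip: A_def B_def)
  qed
qed

text \<open>
  The classical content of the discord bound: \<open>r\<close> is a joint distribution of \<open>(J, X)\<close>, the channel
  \<open>W\<close> produces \<open>K\<close> from \<open>X\<close>, and \<open>H(J|X) \<le> H(J|K)\<close>.
\<close>
lemma conditional_entropy_channel_mono:
  fixes r :: "'j \<Rightarrow> 'x \<Rightarrow> real" and W :: "'k \<Rightarrow> 'x \<Rightarrow> real"
  assumes fin: "finite I" "finite X" "finite K"
    and r: "\<And>j x. j \<in> I \<Longrightarrow> x \<in> X \<Longrightarrow> 0 \<le> r j x"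
    and W: "\<And>k x. k \<in> K \<Longrightarrow> x \<in> X \<Longrightarrow> 0 \<le> W k x"
    and W1: "\<And>x. x \<in> X \<Longrightarrow> (\<Sum>k\<in>K. W k x) = 1"
  defines "s \<equiv> \<lambda>k j. \<Sum>x\<in>X. r j x * W k x"
  shows "(\<Sum>k\<in>K. \<Sum>j\<in>I. s k j * log 2 (s k j / (\<Sum>j\<in>I. s k j)))
      \<le> (\<Sum>j\<in>I. \<Sum>x\<in>X. r j x * log 2 (r j x / (\<Sum>j\<in>I. r j x)))"
proof -
  define t where "t x = (\<Sum>j\<in>I. r j x)" for x
  have t: "0 \<le> t x" "j \<in> I \<Longrightarrow> t x = 0 \<Longrightarrow> r j x = 0" if "x \<in> X" for j x
    using that fin r by (auto simp: t_def sum_nonneg sum_nonneg_eq_0_iff)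
  have q: "(\<Sum>j\<in>I. s k j) = (\<Sum>x\<in>X. t x * W k x)" for k
    by (simp add: s_def t_def sum_distrib_right sum.swap[of _ I X])
  have "s k j * log 2 (s k j / (\<Sum>j\<in>I. s k j)) \<le> (\<Sum>x\<in>X. W k x * (r j x * log 2 (r j x / t x)))"
    if "k \<in> K" "j \<in> I" for k j
  proof -
    have "s k j * log 2 (s k j / (\<Sum>j\<in>I. s k j))
        \<le> (\<Sum>x\<in>X. r j x * W k x * log 2 (r j x * W k x / (t x * W k x)))"
      unfolding q using that fin r W t by (unfold s_def, intro log_sum_inequality) auto
    \<comment> \<open>\<open>W k x\<close> cancels inside the logarithm, and where it is 0 it kills
      both terms.\<close>
    also have "\<dots> = (\<Sum>x\<in>X. W k x * (r j x * log 2 (r j x / t x)))"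
      by (intro sum.cong) auto
    finally show ?thesis .
  qed
  then have "(\<Sum>k\<in>K. \<Sum>j\<in>I. s k j * log 2 (s k j / (\<Sum>j\<in>I. s k j)))
      \<le> (\<Sum>k\<in>K. \<Sum>j\<in>I. \<Sum>x\<in>X. W k x * (r j x * log 2 (r j x / t x)))"
    by (intro sum_mono) auto
  also have "\<dots> = (\<Sum>j\<in>I. \<Sum>x\<in>X. (\<Sum>k\<in>K. W k x) * (r j x * log 2 (r j x / t x)))"
    by (subst sum.swap, simp add: sum_distrib_right, subst sum.swap) (rule refl)
  also have "\<dots> = (\<Sum>j\<in>I. \<Sum>x\<in>X. r j x * log 2 (r j x / t x))"
    by (simp add: W1)
  finally show ?thesis
    by (simp add: t_def)
qed

section \<open>Discord of states with commuting blocks\<close>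

text \<open>The operator sum over j of |j><j| tensor \<open>f j\<close>.\<close>

definition block_diag :: "('m \<Rightarrow> complex ^ 'n ^ 'n) \<Rightarrow> complex ^ ('m \<times> 'n) ^ ('m::finite \<times> 'n::finite)" where
  "block_diag f = (\<chi> r s. if fst r = fst s then f (fst r) $ snd r $ snd s else 0)"

lemma block_diag_nth: "block_diag f $ (i, a) $ (k, c) = (if i = k then f i $ a $ c else 0)"
  by (simp add: block_diag_def)

lemma sum_UNIV_prod:
  "(\<Sum>r\<in>(UNIV :: ('m::finite \<times> 'n::finite) set). f r) = (\<Sum>i\<in>UNIV. \<Sum>a\<in>UNIV. f (i, a))"
  by (simp add: sum.cartesian_product)

lemma kron_mat_1: "kron (mat 1) P = block_diag (\<lambda>_. P)"
  by (simp add: kron_def block_diag_def mat_def vec_eq_iff)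

lemma kron_ketbra_axis:
  "(\<Sum>j\<in>UNIV. w j *\<^sub>R kron (ketbra (axis j 1) (axis j 1)) (\<sigma> j)) = block_diag (\<lambda>j. w j *\<^sub>R \<sigma> j)"
proof -
  have "(\<Sum>j\<in>UNIV. w j *\<^sub>R kron (ketbra (axis j 1) (axis j 1)) (\<sigma> j)) $ r $ s =
      (\<Sum>j\<in>UNIV. if j = fst r then block_diag (\<lambda>j. w j *\<^sub>R \<sigma> j) $ r $ s else 0)" for r s
    unfolding sum_component
    by (intro sum.cong) (auto simp: kron_def ketbra_def axis_def block_diag_def)
  then show ?thesis
    by (simp add: vec_eq_iff)
qed

lemma block_diag_mult: "block_diag f ** block_diag g = block_diag (\<lambda>i. f i ** g i)"
proof -
  have "(block_diag f ** block_diag g) $ (i, a) $ (k, c) = block_diag (\<lambda>i. f i ** g i) $ (i, a) $ (k, c)"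
    for i a k c
  proof -
    have "(block_diag f ** block_diag g) $ (i, a) $ (k, c) =
        (\<Sum>j\<in>UNIV. if j = i then (\<Sum>b\<in>UNIV. if i = k then f i $ a $ b * g i $ b $ c else 0) else 0)"
      unfolding matrix_matrix_mult_def vec_lambda_beta sum_UNIV_prod
      by (intro sum.cong; cases "i = k") (auto simp: block_diag_nth)
    then show ?thesis
      by (simp add: block_diag_def matrix_matrix_mult_def)
  qed
  then show ?thesis
    by (simp add: vec_eq_iff)
qed

lemma trace_block_diag: "trace (block_diag f) = (\<Sum>i\<in>UNIV. trace (f i))"
  by (simp add: trace_def sum_UNIV_prod block_diag_def)

lemma ptrace_fst_block_diag: "ptrace_fst (block_diag f) = (\<Sum>i\<in>UNIV. f i)"
  by (simp add: ptrace_fst_def block_diag_def vec_eq_iff)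

lemma ptrace_snd_block_diag: "ptrace_snd (block_diag f) = (\<chi> i k. if i = k then trace (f i) else 0)"
  by (simp add: ptrace_snd_def block_diag_def vec_eq_iff trace_def)

lemma vn_entropy_diagonal:
  "vn_entropy (\<chi> i k. if i = k then of_real (l i) else 0) = - (\<Sum>i\<in>UNIV. l i * log 2 (l i))"
  by (rule vn_entropy_eigenbasis[OF orthonormal_basis_axis])
    (simp add: vec_eq_iff matrix_vector_mult_def axis_def mult_delta_right)

lemma vn_entropy_block_diag:
  fixes f :: "'m::finite \<Rightarrow> complex ^ 'n ^ 'n" and b :: "'i \<Rightarrow> complex ^ 'n"
  assumes B: "orthonormal_basis_on B b"
    and eig: "\<And>j i. i \<in> B \<Longrightarrow> f j *v b i = of_real (l j i) *s b i"
  shows "vn_entropy (block_diag f) = - (\<Sum>j\<in>UNIV. \<Sum>i\<in>B. l j i * log 2 (l j i))"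
proof -
  \<comment> \<open>\<open>c (j, x)\<close> is the product vector of \<open>axis j 1\<close> and
    \<open>b x\<close>, an eigenvector for \<open>l j x\<close>.\<close>
  define c :: "'m \<times> 'i \<Rightarrow> complex ^ ('m \<times> 'n)" where
    "c y = (\<chi> r. if fst r = fst y then b (snd y) $ snd r else 0)" for y
  have "braket (c (j, x)) (c (k, y)) = (if j = k then braket (b x) (b y) else 0)" for j k x y
  proof -
    have "braket (c (j, x)) (c (k, y)) =
        (\<Sum>i\<in>UNIV. if i = j then (if j = k then braket (b x) (b y) else 0) else 0)"
      unfolding braket_def sum_UNIV_prod by (intro sum.cong) (auto simp: c_def)
    then show ?thesis
      by simp
  qed
  then have "orthonormal_basis_on (UNIV \<times> B) c"
    using B by (auto simp: orthonormal_basis_on_def orthonormal_on_def card_cartesian_product)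
  moreover have "block_diag f *v c y = of_real (l (fst y) (snd y)) *s c y" if "y \<in> UNIV \<times> B" for y
  proof -
    have "(block_diag f *v c y) $ (i, a) = (of_real (l (fst y) (snd y)) *s c y) $ (i, a)" for i a
    proof -
      have "(block_diag f *v c y) $ (i, a) =
          (\<Sum>k\<in>UNIV. if k = i then (if i = fst y then (f i *v b (snd y)) $ a else 0) else 0)"
        unfolding matrix_vector_mult_def vec_lambda_beta sum_UNIV_prod
        by (intro sum.cong) (auto simp: c_def block_diag_def)
      then show ?thesis
        using that eig[of "snd y" i] by (auto simp: c_def)
    qed
    then show ?thesis
      by (simp add: vec_eq_iff)
  qed
  ultimately have "vn_entropy (block_diag f) =
      - (\<Sum>y\<in>UNIV \<times> B. l (fst y) (snd y) * log 2 (l (fst y) (snd y)))"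
    by (rule vn_entropy_eigenbasis)
  then show ?thesis
    by (simp add: sum.cartesian_product case_prod_unfold)
qed

lemma ketbra_vector_mult: "ketbra v w *v u = braket w u *s v"
  by (simp add: vec_eq_iff ketbra_def braket_def matrix_vector_mult_def sum_distrib_left algebra_simps)

lemma sum_matrix_vector_mult: "(\<Sum>i\<in>I. A i) *v v = (\<Sum>i\<in>I. A i *v v)"
  for v :: "complex ^ 'n"
  by (induction I rule: infinite_finite_induct) (simp_all add: matrix_vector_mult_add_rdistrib)

lemma scaleR_matrix_vector_mult: "(c *\<^sub>R A) *v v = of_real c *s (A *v v)"
  for v :: "complex ^ 'n"
  by (simp add: vec_eq_iff matrix_vector_mult_def)
    (simp add: scaleR_conv_of_real sum_distrib_left mult.assoc)

lemma braket_sum_right: "braket v (\<Sum>x\<in>X. f x) = (\<Sum>x\<in>X. braket v (f x))"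
  by (simp add: braket_def sum_distrib_left) (rule sum.swap)

text \<open>
  A classical-quantum state whose blocks share the eigenbasis \<open>b\<close>, with eigenvalues \<open>r j x\<close>. A
  measurement \<open>M\<close> then acts as the classical channel \<open>W P x = \<langle>b x|P|b x\<rangle>\<close>.
\<close>
locale commuting_blocks =
  fixes B :: "'i set" and b :: "'i \<Rightarrow> complex ^ 'n::finite"
    and f :: "'m::finite \<Rightarrow> complex ^ 'n ^ 'n" and r :: "'m \<Rightarrow> 'i \<Rightarrow> real"
  assumes basis: "orthonormal_basis_on B b"
    and eig: "\<And>j x. x \<in> B \<Longrightarrow> f j *v b x = of_real (r j x) *s b x"
    and r_nonneg: "\<And>j x. x \<in> B \<Longrightarrow> 0 \<le> r j x"
begin

definition W :: "complex ^ 'n ^ 'n \<Rightarrow> 'i \<Rightarrow> real" where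
  "W P x = Re (braket (b x) (P *v b x))"

text \<open>Joint weight of index j and outcome P; for a projector it is the trace of
  \<open>P ** f j\<close>.\<close>

definition s :: "complex ^ 'n ^ 'n \<Rightarrow> 'm \<Rightarrow> real" where
  "s P j = (\<Sum>x\<in>B. r j x * W P x)"

lemma finite_B: "finite B"
  using basis by (simp add: orthonormal_basis_on_def)

lemma braket_b: "x \<in> B \<Longrightarrow> y \<in> B \<Longrightarrow> braket (b x) (b y) = (if x = y then 1 else 0)"
  using basis by (simp add: orthonormal_basis_on_def orthonormal_on_def)

context
  fixes P :: "complex ^ 'n ^ 'n"
  assumes P: "conj_transpose P = P" "P ** P = P"
begin

text \<open>Since P = P* P, the expectation is a squared norm, hence real and nonnegative.\<close>

lemma braket_projector: "braket v (P *v v) = of_real (\<Sum>i\<in>UNIV. (cmod ((P *v v) $ i))\<^sup>2)"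
proof -
  have "braket v (P *v v) = braket v (P *v (P *v v))"
    by (simp add: matrix_vector_mul_assoc P)
  also have "\<dots> = braket (P *v v) (P *v v)"
    by (subst braket_adjoint) (simp add: P)
  finally show ?thesis
    by (simp only: braket_self)
qed

lemma W_nonneg: "0 \<le> W P x"
  by (simp add: W_def braket_projector sum_nonneg)

lemma braket_eq_W: "braket (b x) (P *v b x) = of_real (W P x)"
  by (simp add: W_def braket_projector)

lemma trace_projector_mult: "trace (P ** f j) = of_real (s P j)"
proof -
  have "braket (b x) ((P ** f j) *v b x) = of_real (r j x * W P x)" if "x \<in> B" for x
    using that
    by (simp add: eig vec.scale braket_scaleC_right braket_eq_W flip: matrix_vector_mul_assoc)
  then show ?thesis
    by (simp add: trace_eq_sum_braket[OF basis] s_def)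
qed

lemma outcome_prob_block_diag: "outcome_prob (block_diag f) P = (\<Sum>j\<in>UNIV. s P j)"
  by (simp add: outcome_prob_def kron_mat_1 block_diag_mult trace_block_diag trace_projector_mult
      flip: of_real_sum)

text \<open>Cyclicity of the trace and \<open>P ** P = P\<close> remove the second projector; what
  remains is the conditional distribution of the index given the outcome.\<close>

lemma post_state_block_diag:
  "post_state (block_diag f) P =
    (\<chi> i k. if i = k then of_real (s P i / outcome_prob (block_diag f) P) else 0)"
proof -
  have "trace (P ** f j ** P) = of_real (s P j)" for j
    by (subst trace_mul_sym) (simp add: matrix_mul_assoc P trace_projector_mult)
  then show ?thesis
    by (simp add: post_state_def kron_mat_1 block_diag_mult ptrace_snd_block_diag vec_eq_iff)
      (simp add: scaleR_conv_of_real)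
qed

lemma outcome_entropy:
  "outcome_prob (block_diag f) P * vn_entropy (post_state (block_diag f) P) =
    - (\<Sum>j\<in>UNIV. s P j * log 2 (s P j / (\<Sum>j\<in>UNIV. s P j)))"
proof (cases "outcome_prob (block_diag f) P = 0")
  case False
  then show ?thesis
    by (simp add: post_state_block_diag vn_entropy_diagonal sum_distrib_left
        flip: outcome_prob_block_diag)
\<comment> \<open>At outcome probability 0 the quotients are x / 0 = 0 and \<open>ln 0 = 0\<close>,
  so both sides vanish.\<close>
qed (simp add: log_def flip: outcome_prob_block_diag)

end

lemma sum_W:
  assumes "projective_measurement M" and "x \<in> B"
  shows "(\<Sum>P\<in>M. W P x) = 1"
proof -
  have "(\<Sum>P\<in>M. W P x) = Re (braket (b x) ((\<Sum>P\<in>M. P) *v b x))"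
    by (simp add: W_def sum_matrix_vector_mult braket_sum_right)
  then show ?thesis
    using assms by (simp add: projective_measurement_def braket_b)
qed

text \<open>With X the eigenbasis label and K the outcome, this is H(J|K) - H(J|X): the difference
  of state entropies gives -H(J|X), and the post-measurement entropies average to H(J|K).\<close>

lemma discord_wrt_block_diag:
  assumes "projective_measurement M"
  shows "discord_wrt (block_diag f) M =
    (\<Sum>j\<in>UNIV. \<Sum>x\<in>B. r j x * log 2 (r j x / (\<Sum>j\<in>UNIV. r j x))) -
    (\<Sum>P\<in>M. \<Sum>j\<in>UNIV. s P j * log 2 (s P j / (\<Sum>j\<in>UNIV. s P j)))"
proof -
  let ?\<rho> = "block_diag f"
  define t where "t x = (\<Sum>j\<in>UNIV. r j x)" for x
  have "(\<Sum>j\<in>UNIV. f j) *v b x = of_real (t x) *s b x" if "x \<in> B" for x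
  proof -
    have "(\<Sum>j\<in>UNIV. f j) *v b x = (\<Sum>j\<in>UNIV. f j *v b x)"
      by (rule sum_matrix_vector_mult)
    then show ?thesis
      using that by (simp add: eig t_def vec_eq_iff sum_distrib_right)
  qed
  then have "vn_entropy (ptrace_fst ?\<rho>) = - (\<Sum>x\<in>B. t x * log 2 (t x))"
    unfolding ptrace_fst_block_diag by (rule vn_entropy_eigenbasis[OF basis])
  also have "\<dots> = - (\<Sum>j\<in>UNIV. \<Sum>x\<in>B. r j x * log 2 (t x))"
    by (subst sum.swap) (simp add: t_def sum_distrib_right)
  finally have "vn_entropy (ptrace_fst ?\<rho>) - vn_entropy ?\<rho> =
      (\<Sum>j\<in>UNIV. \<Sum>x\<in>B. r j x * log 2 (r j x) - r j x * log 2 (t x))"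
    by (simp add: vn_entropy_block_diag[OF basis eig] sum_subtractf)
  also have "\<dots> = (\<Sum>j\<in>UNIV. \<Sum>x\<in>B. r j x * log 2 (r j x / t x))"
  proof (intro sum.cong refl)
    fix j x
    assume x: "x \<in> B"
    show "r j x * log 2 (r j x) - r j x * log 2 (t x) = r j x * log 2 (r j x / t x)"
    proof (cases "r j x = 0")
      case False
      then have "r j x > 0"
        using r_nonneg[OF x, of j] by simp
      moreover from this have "t x > 0"
        unfolding t_def using r_nonneg[OF x] by (intro sum_pos2[where i = j]) auto
      ultimately show ?thesis
        by (simp add: log_divide algebra_simps)
    qed simp
  qed
  finally have "vn_entropy (ptrace_fst ?\<rho>) - vn_entropy ?\<rho> = \<dots>" .
  moreover have "(\<Sum>P\<in>{P\<in>M. outcome_prob ?\<rho> P \<noteq> 0}. outcome_prob ?\<rho> P * vn_entropy (post_state ?\<rho> P)) =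
      (\<Sum>P\<in>M. outcome_prob ?\<rho> P * vn_entropy (post_state ?\<rho> P))"
    using assms by (intro sum.mono_neutral_left) (auto simp: projective_measurement_def)
  moreover have "\<dots> = (\<Sum>P\<in>M. - (\<Sum>j\<in>UNIV. s P j * log 2 (s P j / (\<Sum>j\<in>UNIV. s P j))))"
    using assms by (intro sum.cong refl outcome_entropy) (auto simp: projective_measurement_def)
  ultimately show ?thesis
    by (simp add: discord_wrt_def t_def sum_negf)
qed

text \<open>The projectors are positive and sum to the identity, so \<open>W\<close> is a classical
  channel from labels to outcomes.\<close>

lemma discord_wrt_block_diag_nonneg:
  assumes "projective_measurement M"
  shows "0 \<le> discord_wrt (block_diag f) M"
proof -
  have M: "finite M" "\<And>P x. P \<in> M \<Longrightarrow> 0 \<le> W P x"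
    using assms W_nonneg by (auto simp: projective_measurement_def)
  show ?thesis
    unfolding discord_wrt_block_diag[OF assms] s_def
    using conditional_entropy_channel_mono[of UNIV B M r W] M finite_B r_nonneg sum_W[OF assms]
    by simp
qed

definition basis_measurement :: "(complex ^ 'n ^ 'n) set" where
  "basis_measurement = (\<lambda>x. ketbra (b x) (b x)) ` B"

text \<open>Measurements are sets of projectors; injectivity lets sums over such a set be reindexed
  by \<open>B\<close>.\<close>

lemma inj_on_ketbra_b: "inj_on (\<lambda>x. ketbra (b x) (b x)) B"
proof (rule inj_onI)
  fix x y
  assume xy: "x \<in> B" "y \<in> B" and eq: "ketbra (b x) (b x) = ketbra (b y) (b y)"
  have "braket (b x) (ketbra (b x) (b x) *v b x) = braket (b x) (ketbra (b y) (b y) *v b x)"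
    by (simp add: eq)
  with xy show "x = y"
    by (simp add: ketbra_vector_mult braket_scaleC_right braket_b split: if_splits)
qed

lemma projective_measurement_basis: "projective_measurement basis_measurement"
proof -
  have "conj_transpose (ketbra (b x) (b x)) = ketbra (b x) (b x)" for x
    by (simp add: vec_eq_iff ketbra_def mult.commute)
  moreover have "ketbra (b x) (b x) ** ketbra (b y) (b y) = (if x = y then ketbra (b x) (b x) else 0)"
    if "x \<in> B" "y \<in> B" for x y
  proof -
    have "(ketbra (b x) (b x) ** ketbra (b y) (b y)) $ i $ k =
        b x $ i * cnj (b y $ k) * braket (b x) (b y)" for i k
      by (simp add: matrix_matrix_mult_def ketbra_def braket_def sum_distrib_left mult_ac)
    with that show ?thesis
      by (simp add: vec_eq_iff braket_b ketbra_def)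
  qed
  moreover have "(\<Sum>P\<in>basis_measurement. P) = mat 1"
    unfolding basis_measurement_def sum.reindex[OF inj_on_ketbra_b]
    by (simp add: vec_eq_iff ketbra_def mat_def orthonormal_basis_completeness[OF basis])
  ultimately show ?thesis
    using finite_B by (auto simp: projective_measurement_def basis_measurement_def)
qed

text \<open>Measuring in the eigenbasis reveals the label exactly: the channel is the identity, so
  H(J|K) = H(J|X).\<close>

lemma discord_wrt_basis_measurement: "discord_wrt (block_diag f) basis_measurement = 0"
proof -
  have "s (ketbra (b x) (b x)) j = r j x" if "x \<in> B" for x j
  proof -
    have "s (ketbra (b x) (b x)) j = (\<Sum>y\<in>B. if y = x then r j x else 0)"
      unfolding s_def W_def using that
      by (intro sum.cong) (auto simp: ketbra_vector_mult braket_scaleC_right braket_b)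
    then show ?thesis
      using that finite_B by simp
  qed
  then have "(\<Sum>P\<in>basis_measurement. \<Sum>j\<in>UNIV. s P j * log 2 (s P j / (\<Sum>j\<in>UNIV. s P j))) =
      (\<Sum>x\<in>B. \<Sum>j\<in>UNIV. r j x * log 2 (r j x / (\<Sum>j\<in>UNIV. r j x)))"
    by (simp add: basis_measurement_def sum.reindex[OF inj_on_ketbra_b])
  also have "\<dots> = (\<Sum>j\<in>UNIV. \<Sum>x\<in>B. r j x * log 2 (r j x / (\<Sum>j\<in>UNIV. r j x)))"
    by (rule sum.swap)
  finally show ?thesis
    by (simp add: discord_wrt_block_diag[OF projective_measurement_basis])
qed

text \<open>Shows that the infimum in \<open>discord\<close> is an attained minimum.\<close>

lemma discord_arg_min_block_diag:
  "is_arg_min (discord_wrt (block_diag f)) projective_measurement basis_measurement"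
  using discord_wrt_block_diag_nonneg
  by (auto simp: is_arg_min_def projective_measurement_basis discord_wrt_basis_measurement not_less)

lemma discord_block_diag: "discord (block_diag f) = 0"
  unfolding discord_def
proof (rule cInf_eq_minimum)
  show "0 \<in> discord_wrt (block_diag f) ` Collect projective_measurement"
    using projective_measurement_basis discord_wrt_basis_measurement by force
qed (auto simp: discord_wrt_block_diag_nonneg)

end

section \<open>The state after the query\<close>

text \<open>1 / |G| times the sum of the translation operators by elements of
  \<open>K\<close>.\<close>

definition subgroup_state ::
  "'g::{finite, ab_group_add} set \<Rightarrow> complex ^ 'g::{finite, ab_group_add} ^ 'g::{finite, ab_group_add}" where
  "subgroup_state K = (\<chi> g h. if g - h \<in> K then 1 / of_nat CARD('g) else 0)"

text \<open>Only x = f g can contribute to the traced sum, and it does so exactly when f g = f h,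
  which hiding turns into membership in \<open>K\<close>.\<close>

lemma ptrace_output_post_query_state:
  fixes f :: "'g::{finite, ab_group_add} \<Rightarrow> 'x"
  assumes "hides f K"
  shows "ptrace_output (\<lambda>r s. post_query_state f r * cnj (post_query_state f s)) = subgroup_state K"
proof -
  let ?N = "complex_of_real (sqrt (real CARD('g)))"
  have amp: "post_query_state f (g, x) = ket (f g) x / ?N" for g x
    by (simp add: post_query_state_def ket_def mult_delta_left)
  have "(\<Sum>\<^sub>\<infinity>x. post_query_state f (g, x) * cnj (post_query_state f (h, x))) =
      (if g - h \<in> K then 1 / of_nat CARD('g) else 0)" for g h
  proof -
    have "(\<Sum>\<^sub>\<infinity>x. post_query_state f (g, x) * cnj (post_query_state f (h, x))) =
        (\<Sum>\<^sub>\<infinity>x\<in>{f g}. post_query_state f (g, x) * cnj (post_query_state f (h, x)))"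
      by (rule infsum_cong_neutral) (auto simp: amp ket_def)
    then show ?thesis
      using assms by (simp add: amp ket_def hides_def of_real_sqrt_CARD_square)
  qed
  then show ?thesis
    by (simp add: ptrace_output_def subgroup_state_def vec_eq_iff)
qed

text \<open>All oracles of a class yield the same reduced state, so averaging over them changes
  nothing.\<close>

lemma class_state_eq_subgroup_state:
  assumes "class_prob F p H j \<noteq> 0"
  shows "class_state F p H j = subgroup_state (H j)"
proof -
  have "(\<Sum>f\<in>hsp_class F H j.
        p f *\<^sub>R ptrace_output (\<lambda>r s. post_query_state f r * cnj (post_query_state f s))) =
      class_prob F p H j *\<^sub>R subgroup_state (H j)"
    unfolding class_prob_def scaleR_sum_left
    by (intro sum.cong) (auto simp: hsp_class_def ptrace_output_post_query_state)
  then show ?thesis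
    using assms by (simp add: class_state_def)
qed

text \<open>Substituting h = g - k turns the matrix action into a convolution; the value at
  \<open>g\<close> factors out and leaves the character sum over \<open>K\<close>.\<close>

lemma subgroup_state_char_vec:
  fixes \<phi> :: "'g::{finite, ab_group_add} \<Rightarrow> complex"
  assumes "is_subgroup K" and "\<phi> \<in> characters"
  shows "subgroup_state K *v char_vec \<phi> =
    of_real (if \<phi> \<in> annihilator K then real (card K) / real CARD('g) else 0) *s char_vec \<phi>"
proof -
  have "(subgroup_state K *v char_vec \<phi>) $ g =
      char_vec \<phi> $ g * ((\<Sum>k\<in>K. \<phi> k) / of_nat CARD('g))" for g
  proof -
    have bij: "bij_betw (\<lambda>k. g - k) UNIV UNIV"
      by (intro bij_betwI[where g = "\<lambda>k. g - k"]) auto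
    have "(subgroup_state K *v char_vec \<phi>) $ g =
        (\<Sum>h\<in>UNIV. subgroup_state K $ g $ h * char_vec \<phi> $ h)"
      by (simp add: matrix_vector_mult_def)
    also have "\<dots> = (\<Sum>k\<in>UNIV. subgroup_state K $ g $ (g - k) * char_vec \<phi> $ (g - k))"
      by (rule sum.reindex_bij_betw[OF bij, symmetric])
    also have "\<dots> = (\<Sum>k\<in>UNIV. if k \<in> K then char_vec \<phi> $ g * (\<phi> k / of_nat CARD('g)) else 0)"
      using assms by (intro sum.cong) (auto simp: subgroup_state_def char_vec_nth character_diff)
    also have "\<dots> = char_vec \<phi> $ g * ((\<Sum>k\<in>K. \<phi> k) / of_nat CARD('g))"
      by (simp add: sum.If_cases sum_distrib_left sum_divide_distrib)
    finally show ?thesis .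
  qed
  then show ?thesis
    using assms by (simp add: vec_eq_iff sum_character_subgroup)
qed

lemma subgroup_state_mult_nth:
  "(subgroup_state K ** subgroup_state L) $ g $ h =
    of_nat (card {k. g - k \<in> K \<and> k - h \<in> L}) / (of_nat CARD('g))\<^sup>2"
  for K L :: "'g::{finite, ab_group_add} set"
proof -
  have "(subgroup_state K ** subgroup_state L) $ g $ h =
      (\<Sum>k\<in>UNIV. if k \<in> {k. g - k \<in> K \<and> k - h \<in> L} then 1 / (of_nat CARD('g))\<^sup>2 else 0)"
    unfolding matrix_matrix_mult_def vec_lambda_beta
    by (intro sum.cong) (auto simp: subgroup_state_def power2_eq_square)
  then show ?thesis
    by (subst (asm) sum.If_cases) simp_all
qed

text \<open>Both products count intermediate points, and the reflection \<open>g + h - k\<close>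
  exchanges the two membership conditions.\<close>

lemma subgroup_state_commute:
  fixes K L :: "'g::{finite, ab_group_add} set"
  shows "subgroup_state K ** subgroup_state L = subgroup_state L ** subgroup_state K"
proof -
  have "card {k. g - k \<in> K \<and> k - h \<in> L} = card {k. g - k \<in> L \<and> k - h \<in> K}" for g h
    by (rule bij_betw_same_card[of "\<lambda>k. g + h - k"], rule bij_betwI[where g = "\<lambda>k. g + h - k"])
      (auto simp: algebra_simps)
  then show ?thesis
    by (simp add: vec_eq_iff subgroup_state_mult_nth)
qed

text \<open>Since \<open>L\<close> is closed under negation, k \<mapsto> g - k carries the points
  counted by each diagonal entry onto \<open>K \<inter> L\<close>.\<close>

lemma trace_subgroup_state_mult:
  fixes K L :: "'g::{finite, ab_group_add} set"
  assumes "is_subgroup L"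
  shows "trace (subgroup_state K ** subgroup_state L) = of_nat (card (K \<inter> L)) / of_nat CARD('g)"
proof -
  have "card {k. g - k \<in> K \<and> k - g \<in> L} = card (K \<inter> L)" for g
  proof -
    have "k - g \<in> L \<longleftrightarrow> g - k \<in> L" for k
      using assms unfolding is_subgroup_def by (metis minus_diff_eq)
    then show ?thesis
      by (intro bij_betw_same_card[of "\<lambda>k. g - k"] bij_betwI[where g = "\<lambda>k. g - k"]) auto
  qed
  then show ?thesis
    by (simp add: trace_def subgroup_state_mult_nth power2_eq_square)
qed

text \<open>The nonzero eigenvalue |K| / |G| has multiplicity |G| / |K|, the size of the
  annihilator.\<close>

lemma vn_entropy_subgroup_state:
  fixes K :: "'g::{finite, ab_group_add} set"
  assumes "is_subgroup K"
  shows "vn_entropy (subgroup_state K) = log 2 (real CARD('g)) - log 2 (real (card K))"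
proof -
  have K: "card K > 0"
    using assms by (auto simp: is_subgroup_def card_gt_0_iff)
  have sub: "annihilator K \<subseteq> characters"
    by (auto simp: annihilator_def)
  define x where "x = real (card K) / real CARD('g)"
  have "vn_entropy (subgroup_state K) =
      - (\<Sum>\<phi>\<in>characters. (if \<phi> \<in> annihilator K then x else 0) *
          log 2 (if \<phi> \<in> annihilator K then x else 0))"
    unfolding x_def
    by (rule vn_entropy_eigenbasis[OF orthonormal_basis_char_vec]) (rule subgroup_state_char_vec[OF assms])
  also have "\<dots> = - (\<Sum>\<phi>\<in>characters. if \<phi> \<in> annihilator K then x * log 2 x else 0)"
    by (intro arg_cong[where f = uminus] sum.cong) auto
  also have "\<dots> = - (real (card (annihilator K)) * x * log 2 x)"
    using sub by (simp add: sum.If_cases finite_characters Int_absorb1)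
  also have "real (card (annihilator K)) * x = 1"
    using card_annihilator[OF assms] K by (simp add: x_def flip: of_nat_mult)
  finally show ?thesis
    using K by (simp add: x_def log_divide card_gt_0_iff)
qed

section \<open>Shannon entropies under a uniform conditional law\<close>

context prob_space
begin

lemma joint_prob_uniform_conditional:
  fixes J :: "'a \<Rightarrow> 'j::finite" and Y :: "'a \<Rightarrow> 'g::finite"
  assumes J: "simple_function M J" and Y: "simple_function M Y"
    and cond: "\<And>j g. \<P>(\<omega> in M. Y \<omega> = g \<bar> J \<omega> = j) = 1 / real CARD('g)"
  shows "prob {\<omega>\<in>space M. J \<omega> = j} > 0"
    and "prob {\<omega>\<in>space M. Y \<omega> = g \<and> J \<omega> = j} = prob {\<omega>\<in>space M. J \<omega> = j} / real CARD('g)"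
    and "prob {\<omega>\<in>space M. Y \<omega> = g} = 1 / real CARD('g)"
proof -
  note [measurable] = measurable_simple_function[OF J] measurable_simple_function[OF Y]
  \<comment> \<open>A conditional probability given a null event is 0 by default, so the value 1 /
    |G| forces the condition to have positive probability.\<close>
  have pos: "prob {\<omega>\<in>space M. J \<omega> = j} \<noteq> 0" for j
    using cond[of undefined j] by (auto simp: cond_prob_def)
  then show "prob {\<omega>\<in>space M. J \<omega> = j} > 0"
    by (simp add: zero_less_measure_iff)
  have joint: "prob {\<omega>\<in>space M. Y \<omega> = g \<and> J \<omega> = j} = prob {\<omega>\<in>space M. J \<omega> = j} / real CARD('g)" for g j
    using cond[of g j] pos[of j] by (simp add: cond_prob_def field_simps)
  then show "prob {\<omega>\<in>space M. Y \<omega> = g \<and> J \<omega> = j} = prob {\<omega>\<in>space M. J \<omega> = j} / real CARD('g)" .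
  have total: "(\<Sum>j\<in>UNIV. prob {\<omega>\<in>space M. P \<omega> \<and> J \<omega> = j}) = prob {\<omega>\<in>space M. P \<omega>}"
    if "{\<omega>\<in>space M. P \<omega>} \<in> sets M" for P
  proof -
    have "prob (\<Union>j\<in>UNIV. {\<omega>\<in>space M. P \<omega> \<and> J \<omega> = j}) =
        (\<Sum>j\<in>UNIV. prob {\<omega>\<in>space M. P \<omega> \<and> J \<omega> = j})"
      using that by (intro finite_measure_finite_Union) (auto simp: disjoint_family_on_def)
    moreover have "(\<Union>j\<in>UNIV. {\<omega>\<in>space M. P \<omega> \<and> J \<omega> = j}) = {\<omega>\<in>space M. P \<omega>}"
      by auto
    ultimately show ?thesis
      by simp
  qed
  have "prob {\<omega>\<in>space M. Y \<omega> = g} = (\<Sum>j\<in>UNIV. prob {\<omega>\<in>space M. J \<omega> = j}) / real CARD('g)"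
    using total[of "\<lambda>\<omega>. Y \<omega> = g"] by (simp add: joint sum_divide_distrib)
  also have "(\<Sum>j\<in>UNIV. prob {\<omega>\<in>space M. J \<omega> = j}) = 1"
    using total[of "\<lambda>_. True"] by (simp add: prob_space)
  finally show "prob {\<omega>\<in>space M. Y \<omega> = g} = 1 / real CARD('g)" .
qed

text \<open>The joint law is the product of its marginals, so the mutual information is 0 in either
  order, and H(Y|J) = H(Y) - I(Y;J).\<close>

lemma entropy_uniform_conditional:
  fixes J :: "'a \<Rightarrow> 'j::finite" and Y :: "'a \<Rightarrow> 'g::finite"
  assumes J: "simple_function M J" and Y: "simple_function M Y"
    and cond: "\<And>j g. \<P>(\<omega> in M. Y \<omega> = g \<bar> J \<omega> = j) = 1 / real CARD('g)"
  shows "conditional_entropy 2 (count_space (Y ` space M)) (count_space (J ` space M)) Y J =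
      entropy 2 (count_space (Y ` space M)) Y"
    and "entropy 2 (count_space (Y ` space M)) Y = log 2 (real CARD('g))"
    and "mutual_information 2 (count_space (J ` space M)) (count_space (Y ` space M)) J Y = 0"
proof -
  interpret information_space M 2
    by unfold_locales simp
  note probs = joint_prob_uniform_conditional[OF J Y cond]
  have vimage: "Y -` {g} \<inter> space M = {\<omega>\<in>space M. Y \<omega> = g}"
    "J -` {j} \<inter> space M = {\<omega>\<in>space M. J \<omega> = j}"
    "(\<lambda>\<omega>. (Y \<omega>, J \<omega>)) -` {(g, j)} \<inter> space M = {\<omega>\<in>space M. Y \<omega> = g \<and> J \<omega> = j}"
    "(\<lambda>\<omega>. (J \<omega>, Y \<omega>)) -` {(j, g)} \<inter> space M = {\<omega>\<in>space M. Y \<omega> = g \<and> J \<omega> = j}" for g j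
    by auto
  have dY: "simple_distributed M Y (\<lambda>_. 1 / real CARD('g))"
    by (rule simple_distributedI[OF Y]) (simp_all add: vimage probs(3))
  have dJ: "simple_distributed M J (\<lambda>j. prob {\<omega>\<in>space M. J \<omega> = j})"
    by (rule simple_distributedI[OF J]) (simp_all add: vimage)
  have dYJ: "simple_distributed M (\<lambda>\<omega>. (Y \<omega>, J \<omega>)) (\<lambda>(g, j). prob {\<omega>\<in>space M. J \<omega> = j} / real CARD('g))"
    by (rule simple_distributedI[OF simple_function_Pair[OF Y J]])
      (auto simp: vimage probs(2))
  have dJY: "simple_distributed M (\<lambda>\<omega>. (J \<omega>, Y \<omega>)) (\<lambda>(j, g). prob {\<omega>\<in>space M. J \<omega> = j} / real CARD('g))"
    by (rule simple_distributedI[OF simple_function_Pair[OF J Y]])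
      (auto simp: vimage probs(2))
  have "mutual_information 2 (count_space (Y ` space M)) (count_space (J ` space M)) Y J = 0"
    by (rule mutual_information_eq_0_simple[OF dY dJ dYJ]) simp
  then show "conditional_entropy 2 (count_space (Y ` space M)) (count_space (J ` space M)) Y J =
      entropy 2 (count_space (Y ` space M)) Y"
    using mutual_information_eq_entropy_conditional_entropy[OF Y J] by simp
  show "mutual_information 2 (count_space (J ` space M)) (count_space (Y ` space M)) J Y = 0"
    by (rule mutual_information_eq_0_simple[OF dJ dY dJY]) simp
  \<comment> \<open>Entropy sums over the range of \<open>Y\<close>; positive probabilities make
    that range the whole group, giving |G| terms.\<close>
  have "g \<in> Y ` space M" for g
  proof (rule ccontr)
    assume "g \<notin> Y ` space M"
    then have "{\<omega>\<in>space M. Y \<omega> = g} = {}"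
      by auto
    with probs(3)[of g] show False
      by simp
  qed
  then have "Y ` space M = UNIV"
    by auto
  then show "entropy 2 (count_space (Y ` space M)) Y = log 2 (real CARD('g))"
    using entropy_simple_distributed[OF dY] by (simp add: log_divide)
qed

end

section \<open>The class index as a random variable, and assembly of the claims\<close>

text \<open>The hidden subgroup is recovered as the set of g with f g = f 0.\<close>

lemma hides_unique: "hides f K \<Longrightarrow> hides f L \<Longrightarrow> K = L"
  by (auto simp: hides_def) (metis diff_zero)+

text \<open>Distinct subgroups have disjoint classes, so the index is a function of the oracle: its
  level sets are preimages of classes under \<open>f_rv\<close>.\<close>

lemma simple_function_class_index:
  fixes J :: "'w \<Rightarrow> 'j::finite"
  assumes "inj H" and f_rv: "f_rv \<in> M \<rightarrow>\<^sub>M count_space F"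
    and J: "\<And>\<omega>. \<omega> \<in> space M \<Longrightarrow> f_rv \<omega> \<in> hsp_class F H (J \<omega>)"
  shows "simple_function M J"
proof -
  have "J \<omega> = j \<longleftrightarrow> f_rv \<omega> \<in> hsp_class F H j" if "\<omega> \<in> space M" for \<omega> j
    using J[OF that] \<open>inj H\<close> by (auto simp: hsp_class_def dest: hides_unique injD)
  then have "J -` {j} \<inter> space M = f_rv -` hsp_class F H j \<inter> space M" for j
    by auto
  moreover have "f_rv -` hsp_class F H j \<inter> space M \<in> sets M" for j
    by (rule measurable_sets[OF f_rv]) (auto simp: hsp_class_def)
  ultimately show ?thesis
    by (simp add: simple_function_def)
qed

theorem mainTheorem5:
  fixes F :: "('g::{finite, ab_group_add} \<Rightarrow> 'x) set"
    and p :: "('g \<Rightarrow> 'x) \<Rightarrow> real"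
    and H :: "'j::finite \<Rightarrow> 'g set"
    and M :: "'w measure"
    and f_rv :: "'w \<Rightarrow> 'g \<Rightarrow> 'x"
    and J :: "'w \<Rightarrow> 'j"
    and Y2 :: "'w \<Rightarrow> 'g"
  assumes "finite F"
    and "inj H"
    and "\<And>f. f \<in> F \<Longrightarrow> \<exists>j. hides f (H j)"
    and "\<And>j. hsp_class F H j \<noteq> {}"
    and "\<And>j. class_prob F p H j > 0"
    and "prob_space M"
    and "f_rv \<in> M \<rightarrow>\<^sub>M count_space F"
    and "\<And>f. f \<in> F \<Longrightarrow> \<P>(\<omega> in M. f_rv \<omega> = f) = p f"
    and "\<And>\<omega>. \<omega> \<in> space M \<Longrightarrow> f_rv \<omega> \<in> hsp_class F H (J \<omega>)"
    and "Y2 \<in> M \<rightarrow>\<^sub>M count_space UNIV"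
    and "\<And>j g. complex_of_real \<P>(\<omega> in M. Y2 \<omega> = g \<bar> J \<omega> = j) =
                 braket (axis g 1) (class_state F p H j *v axis g 1)"
  shows
    "(prob_space.conditional_entropy M 2
        (count_space (Y2 ` space M)) (count_space (J ` space M)) Y2 J =
          prob_space.entropy M 2 (count_space (Y2 ` space M)) Y2 \<and>
      prob_space.entropy M 2 (count_space (Y2 ` space M)) Y2 = log 2 (real CARD('g)) \<and>
      prob_space.mutual_information M 2
        (count_space (J ` space M)) (count_space (Y2 ` space M)) J Y2 = 0) \<and>
     ((\<forall>j j'.
         class_state F p H j ** class_state F p H j' - class_state F p H j' ** class_state F p H j = 0 \<and>
         trace (class_state F p H j ** class_state F p H j') =
           of_nat (card (H j \<inter> H j')) / of_nat CARD('g) \<and>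
         trace (class_state F p H j ** class_state F p H j') \<noteq> 0) \<and>
      (\<exists>P. is_arg_min (discord_wrt (joint_state F p H)) projective_measurement P) \<and>
      discord (joint_state F p H) = 0) \<and>
     (\<forall>j. vn_entropy (class_state F p H j) = log 2 (real CARD('g)) - log 2 (real (card (H j)))) \<and>
     ((\<forall>\<phi>\<in>characters. \<forall>\<phi>'\<in>characters.
         braket (char_vec \<phi> :: complex ^ 'g::{finite, ab_group_add}) (char_vec \<phi>') = (if \<phi> = \<phi>' then 1 else 0)) \<and>
      vec.span (char_vec ` characters) = (UNIV :: (complex ^ 'g::{finite, ab_group_add}) set) \<and>
      (\<forall>\<phi>\<in>characters. \<forall>j. \<exists>c. class_state F p H j *v char_vec \<phi> = c *s char_vec \<phi>) \<and>
      (\<forall>\<phi>\<in>characters.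
         input_state F p H *v char_vec \<phi> = of_real (eig_val F p H \<phi>) *s char_vec \<phi>)) \<and>
     ((\<forall>j. class_prob F p H j = 1 / real CARD('j)) \<longrightarrow>
       (\<forall>\<phi>\<in>characters. of_real (eig_val F p H \<phi>) =
          of_real (1 / (sqrt (real CARD('g)) * real CARD('j))) *
            braket (count_vec H) (char_vec \<phi>)))"
proof -
  have cp: "class_prob F p H j > 0" for j
    by fact
  have sub: "is_subgroup (H j)" for j
    using \<open>hsp_class F H j \<noteq> {}\<close> by (auto simp: hsp_class_def hides_def)
  have \<sigma>: "class_state F p H j = subgroup_state (H j)" for j
    by (rule class_state_eq_subgroup_state) (use cp[of j] in simp)
  interpret prob_space M
    by fact
  have J: "simple_function M J"
    by (rule simple_function_class_index) fact+
  have Y2: "simple_function M Y2"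
    using \<open>Y2 \<in> M \<rightarrow>\<^sub>M count_space UNIV\<close> by (auto simp: simple_function_def intro: measurable_sets)
  have zero: "0 \<in> H j" for j
    using sub by (simp add: is_subgroup_def)
  \<comment> \<open>The diagonal entry at \<open>g\<close> depends on whether g - g = 0 lies in
    \<open>H j\<close>, which always holds.\<close>
  have "complex_of_real \<P>(\<omega> in M. Y2 \<omega> = g \<bar> J \<omega> = j) = of_real (1 / real CARD('g))" for j g
    unfolding assms(11) braket_axis_left
    by (simp add: \<sigma> matrix_vector_mult_def axis_def mult_delta_right)
      (simp add: subgroup_state_def zero)
  then have cond: "\<P>(\<omega> in M. Y2 \<omega> = g \<bar> J \<omega> = j) = 1 / real CARD('g)" for j g
    by (simp only: of_real_eq_iff)

  define l where "l j \<phi> = (if \<phi> \<in> annihilator (H j) then real (card (H j)) / real CARD('g) else 0)"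
    for j \<phi>
  have \<sigma>_char: "subgroup_state (H j) *v char_vec \<phi> = of_real (l j \<phi>) *s char_vec \<phi>"
    if "\<phi> \<in> characters" for j \<phi>
    unfolding l_def by (rule subgroup_state_char_vec[OF sub that])
  have eig: "(class_prob F p H j *\<^sub>R subgroup_state (H j)) *v char_vec \<phi> =
      of_real (class_prob F p H j * l j \<phi>) *s char_vec \<phi>" if "\<phi> \<in> characters" for j \<phi>
    using that by (simp add: scaleR_matrix_vector_mult \<sigma>_char)
  have joint: "joint_state F p H = block_diag (\<lambda>j. class_prob F p H j *\<^sub>R subgroup_state (H j))"
    by (simp add: joint_state_def \<sigma> kron_ketbra_axis)
  interpret commuting_blocks characters char_vec "\<lambda>j. class_prob F p H j *\<^sub>R subgroup_state (H j)"
    "\<lambda>j \<phi>. class_prob F p H j * l j \<phi>"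
    using cp by unfold_locales (auto simp: orthonormal_basis_char_vec eig l_def less_imp_le)

  have input: "input_state F p H *v char_vec \<phi> = of_real (eig_val F p H \<phi>) *s char_vec \<phi>"
    if "\<phi> \<in> characters" for \<phi>
  proof -
    have "eig_val F p H \<phi> = (\<Sum>j\<in>UNIV. class_prob F p H j * l j \<phi>)"
      unfolding eig_val_def l_def
      by (simp add: if_distrib sum.If_cases sum_divide_distrib cong: if_cong)
    then show ?thesis
      using that
      by (simp add: input_state_def \<sigma> sum_matrix_vector_mult eig flip: vec.scale_sum_left)
  qed

  have count: "of_real (eig_val F p H \<phi>) =
      of_real (1 / (sqrt (real CARD('g)) * real CARD('j))) * braket (count_vec H) (char_vec \<phi>)"
    if uniform: "\<And>j. class_prob F p H j = 1 / real CARD('j)" and "\<phi> \<in> characters" for \<phi>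
  proof -
    have "count_vec H $ g = of_nat (card {j. g \<in> H j})" for g
      by (simp add: count_vec_def axis_def mult_delta_right)
    \<comment> \<open>Each count is written as a sum of indicators over \<open>j\<close>, so
      exchanging the sums yields one character sum per subgroup.\<close>
    then have "braket (count_vec H) (char_vec \<phi>) =
        (\<Sum>g\<in>UNIV. \<Sum>j\<in>UNIV. if g \<in> H j then cnj (\<phi> g) else 0) / of_real (sqrt (real CARD('g)))"
      by (simp add: braket_def char_vec_nth sum.If_cases sum_divide_distrib)
    also have "(\<Sum>g\<in>UNIV. \<Sum>j\<in>UNIV. if g \<in> H j then cnj (\<phi> g) else 0) =
        (\<Sum>j\<in>UNIV. cnj (\<Sum>g\<in>H j. \<phi> g))"
      by (subst sum.swap) (simp add: sum.If_cases)
    \<comment> \<open>The character sums are 0 or |H_j|, so the conjugation disappears.\<close>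
    also have "\<dots> = of_nat (\<Sum>j\<in>{j. \<phi> \<in> annihilator (H j)}. card (H j))"
      using that by (simp add: sum_character_subgroup[OF sub] if_distrib[of cnj] sum.If_cases cong: if_cong)
    \<comment> \<open>One factor sqrt |G| comes from \<open>char_vec\<close>, the other from the
      prefactor; together they give the 1 / |G| of \<open>eig_val\<close>.\<close>
    finally show ?thesis
      unfolding eig_val_def uniform
      by (simp add: of_real_sqrt_CARD_square flip: sum_distrib_left sum_divide_distrib)
  qed

  have "card (H j \<inter> H j') \<noteq> 0" for j j'
    using zero by (auto simp: card_eq_0_iff)
  then show ?thesis
    using entropy_uniform_conditional[OF J Y2 cond] discord_arg_min_block_diag discord_block_diag
      input count \<sigma>_char
    by (auto simp: \<sigma> joint subgroup_state_commute trace_subgroup_state_mult[OF sub]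
        vn_entropy_subgroup_state[OF sub] braket_char_vec span_char_vec)
qed

end
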